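(* Let $\theta=2\cos(2\pi/15)=\zeta_{15}+\zeta_{15}^{-1}$ with $\zeta_{15}=e^{2\pi i/15}$, $F=\mathbb{Q}(i)$, $K=\mathbb{Q}(i,\theta)$, let $\sigma$ be the generator of $\mathrm{Gal}(K/F)$ given by $\zeta_{15}+\zeta_{15}^{-1}\mapsto\zeta_{15}^2+\zeta_{15}^{-2}$, and let $\gamma=i$. Let $\alpha=(1-3i)+i\theta^2$ and $\mathcal{I}=\alpha\mathcal{O}_K$. Then $$\nu_1=(1-3i)+i\theta^2,\quad \nu_2=(1-3i)\theta+i\theta^3,\quad \nu_3=-i+(-3+4i)\theta+(1-i)\theta^3,\quad \nu_4=(-1+i)-3\theta+\theta^2+\theta^3$$ is a $\mathbb{Z}[i]$-basis of $\mathcal{I}$, and the $4\times4$ space-time code $\mathcal{C}(K/F,\sigma,\gamma,(\nu_k),c)$ with $c=15$ is perfect.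
   Context: $\mathcal{O}_L$ denotes the ring of integers of a number field $L$. Code: let $F$ be $\mathbb{Q}(i)$ or $\mathbb{Q}(j)$ with $j=e^{2\pi i/3}$, $K\subset\mathbb{C}$ a cyclic extension of $F$ of degree $n$, $\sigma$ a generator of $\mathrm{Gal}(K/F)$, $\gamma\in F^*$, $(\nu_1,\dots,\nu_n)$ an $\mathcal{O}_F$-basis of a nonzero ideal of $\mathcal{O}_K$, and $c>0$ a real number. Given information symbols $u_{\ell,k}\in\mathcal{O}_F$ ($0\le \ell\le n-1$, $1\le k\le n$), put $x_\ell=\sum_{k=1}^n u_{\ell,k}\nu_k$. The infinite code $\mathcal{C}(K/F,\sigma,\gamma,(\nu_k),c)$ is the set of all $n\times n$ complex matrices $\frac{1}{\sqrt c}X$, where (indices $r,s\in\{0,\dots,n-1\}$) $X_{r,s}=\sigma^r(x_{s-r})$ if $s\ge r$ and $X_{r,s}=\gamma\,\sigma^r(x_{s-r+n})$ if $s<r$. The code is called perfect if: (1) (full rate) it encodes $n^2$ information symbols, i.e. the symbols $u_{\ell,k}$ are determined by the codeword; (2) (non-vanishing determinant) there is $\delta>0$ such that $|\det \mathbf{X}|^2\ge\delta$ for every nonzero codeword $\mathbf{X}$ of the infinite code; (3) (shaping) the layer-encoding matrix $R=\frac{1}{\sqrt c}\big(\sigma^{r}(\nu_k)\big)_{0\le r\le n-1,\,1\le k\le n}$ is unitary; (4) (uniform average energy per antenna) $|\gamma|=1$. *)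

theory Defs
  imports
    "HOL-Analysis.Analysis"
    "HOL-Algebra.Algebra"
    "HOL-Algebra.Algebraic_Closure_Type"
    "Jordan_Normal_Form.Determinant"
    "Jordan_Normal_Form.Schur_Decomposition"
begin

text \<open>All fields are subfields of the complex numbers.\<close>

abbreviation complex_field :: "complex ring" where
  "complex_field \<equiv> ring_of_type_algebra"

definition adjoin :: "complex set \<Rightarrow> complex set" where
  "adjoin S = generate_field complex_field S"
  \<comment> \<open>the smallest subfield of the complex numbers containing \<open>S\<close>, i.e. the extension of the
    rationals generated by \<open>S\<close>\<close>

definition ring_of_integers :: "complex set \<Rightarrow> complex ring" where
  "ring_of_integers L = complex_field \<lparr>carrier := {x \<in> L. algebraic_int x}\<rparr>"

definition gaussian_ints :: "complex set" where
  "gaussian_ints = {of_int a + of_int b * \<i> | a b. True}"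


subsection \<open>Cyclic extensions\<close>

text \<open>Automorphisms are extensional functions (undefined outside \<open>K\<close>), as for
  \<^const>\<open>BijGroup\<close> and \<^const>\<open>AutoGroup\<close>.\<close>

definition galois_group :: "complex set \<Rightarrow> complex set \<Rightarrow> (complex \<Rightarrow> complex) monoid" where
  "galois_group K F = BijGroup K \<lparr>carrier :=
     {\<tau> \<in> Bij K. \<tau> \<in> Ring.ring_hom (complex_field \<lparr>carrier := K\<rparr>) (complex_field \<lparr>carrier := K\<rparr>)
              \<and> (\<forall>x\<in>F. \<tau> x = x)}\<rparr>"

definition galois_extension :: "nat \<Rightarrow> complex set \<Rightarrow> complex set \<Rightarrow> bool" where
  "galois_extension n K F \<longleftrightarrow>
     subfield F complex_field \<and> subfield K complex_field \<and> F \<subseteq> K \<and>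
     ring.dimension complex_field n F K \<and>
     {x \<in> K. \<forall>\<tau> \<in> carrier (galois_group K F). \<tau> x = x} = F"

definition cyclic_extension :: "nat \<Rightarrow> complex set \<Rightarrow> complex set \<Rightarrow> bool" where
  "cyclic_extension n K F \<longleftrightarrow> galois_extension n K F \<and> cyclic_group (galois_group K F)"

definition is_generator :: "('a, 'b) monoid_scheme \<Rightarrow> 'a \<Rightarrow> bool" where
  "is_generator G g \<longleftrightarrow> g \<in> carrier G \<and> generate G {g} = carrier G"

definition is_module_basis :: "complex set \<Rightarrow> complex list \<Rightarrow> complex set \<Rightarrow> bool" where
  "is_module_basis A vs M \<longleftrightarrow>
     {(\<Sum>k<length vs. a k * vs ! k) | a. \<forall>k<length vs. a k \<in> A} = M \<and>
     (\<forall>a. (\<forall>k<length vs. a k \<in> A) \<and> (\<Sum>k<length vs. a k * vs ! k) = 0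
          \<longrightarrow> (\<forall>k<length vs. a k = 0))"


subsection \<open>The code\<close>

text \<open>The basis \<open>\<nu>\<^sub>1, \<dots>, \<nu>\<^sub>n\<close> is a list, so that the index \<open>k\<close> runs over \<open>0, \<dots>, n - 1\<close>; the degree
  \<open>n\<close> is its length. Since \<open>\<sigma>\<close> maps \<open>K\<close> to itself, the power \<open>\<sigma>\<^sup>r\<close> on \<open>K\<close> is \<open>\<sigma> ^^ r\<close>.\<close>

definition code_data ::
  "complex set \<Rightarrow> complex set \<Rightarrow> (complex \<Rightarrow> complex) \<Rightarrow> complex \<Rightarrow> complex list \<Rightarrow> real \<Rightarrow> bool" where
  "code_data K F \<sigma> \<gamma> \<nu> c \<longleftrightarrow>
     F \<in> {adjoin {\<i>}, adjoin {exp (2 * of_real pi * \<i> / 3)}} \<and>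
     cyclic_extension (length \<nu>) K F \<and>
     is_generator (galois_group K F) \<sigma> \<and>
     \<gamma> \<in> F - {0} \<and>
     (\<exists>I. ideal I (ring_of_integers K) \<and> I \<noteq> {0} \<and>
          is_module_basis (carrier (ring_of_integers F)) \<nu> I) \<and>
     c > 0"

definition symbol_arrays :: "complex set \<Rightarrow> nat \<Rightarrow> (nat \<Rightarrow> nat \<Rightarrow> complex) set" where
  "symbol_arrays F n = {u. \<forall>l<n. \<forall>k<n. u l k \<in> carrier (ring_of_integers F)}"

definition layer :: "complex list \<Rightarrow> (nat \<Rightarrow> nat \<Rightarrow> complex) \<Rightarrow> nat \<Rightarrow> complex" where
  "layer \<nu> u l = (\<Sum>k<length \<nu>. u l k * \<nu> ! k)"

definition codeword ::
  "(complex \<Rightarrow> complex) \<Rightarrow> complex \<Rightarrow> complex list \<Rightarrow> real \<Rightarrow> (nat \<Rightarrow> nat \<Rightarrow> complex) \<Rightarrow> complex mat" where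
  "codeword \<sigma> \<gamma> \<nu> c u =
     complex_of_real (1 / sqrt c) \<cdot>\<^sub>m
       mat (length \<nu>) (length \<nu>) (\<lambda>(r, s).
         if r \<le> s then (\<sigma> ^^ r) (layer \<nu> u (s - r))
         else \<gamma> * (\<sigma> ^^ r) (layer \<nu> u (s + length \<nu> - r)))"

definition infinite_code ::
  "complex set \<Rightarrow> (complex \<Rightarrow> complex) \<Rightarrow> complex \<Rightarrow> complex list \<Rightarrow> real \<Rightarrow> complex mat set" where
  "infinite_code F \<sigma> \<gamma> \<nu> c = codeword \<sigma> \<gamma> \<nu> c ` symbol_arrays F (length \<nu>)"

definition layer_matrix :: "(complex \<Rightarrow> complex) \<Rightarrow> complex list \<Rightarrow> real \<Rightarrow> complex mat" where
  "layer_matrix \<sigma> \<nu> c =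
     complex_of_real (1 / sqrt c) \<cdot>\<^sub>m
       mat (length \<nu>) (length \<nu>) (\<lambda>(r, k). (\<sigma> ^^ r) (\<nu> ! k))"

definition unitary_mat :: "complex mat \<Rightarrow> bool" where
  "unitary_mat U \<longleftrightarrow> square_mat U \<and> inverts_mat U (mat_adjoint U) \<and> inverts_mat (mat_adjoint U) U"

definition full_rate ::
  "complex set \<Rightarrow> (complex \<Rightarrow> complex) \<Rightarrow> complex \<Rightarrow> complex list \<Rightarrow> real \<Rightarrow> bool" where
  "full_rate F \<sigma> \<gamma> \<nu> c \<longleftrightarrow>
     (\<forall>u \<in> symbol_arrays F (length \<nu>). \<forall>v \<in> symbol_arrays F (length \<nu>).
        codeword \<sigma> \<gamma> \<nu> c u = codeword \<sigma> \<gamma> \<nu> c v \<longrightarrow>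
        (\<forall>l<length \<nu>. \<forall>k<length \<nu>. u l k = v l k))"

definition nonvanishing_det ::
  "complex set \<Rightarrow> (complex \<Rightarrow> complex) \<Rightarrow> complex \<Rightarrow> complex list \<Rightarrow> real \<Rightarrow> bool" where
  "nonvanishing_det F \<sigma> \<gamma> \<nu> c \<longleftrightarrow>
     (\<exists>\<delta>>0. \<forall>A \<in> infinite_code F \<sigma> \<gamma> \<nu> c.
        A \<noteq> 0\<^sub>m (length \<nu>) (length \<nu>) \<longrightarrow> (cmod (Determinant.det A))\<^sup>2 \<ge> \<delta>)"

definition perfect_code ::
  "complex set \<Rightarrow> (complex \<Rightarrow> complex) \<Rightarrow> complex \<Rightarrow> complex list \<Rightarrow> real \<Rightarrow> bool" where
  "perfect_code F \<sigma> \<gamma> \<nu> c \<longleftrightarrow>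
     full_rate F \<sigma> \<gamma> \<nu> c \<and> nonvanishing_det F \<sigma> \<gamma> \<nu> c \<and>
     unitary_mat (layer_matrix \<sigma> \<nu> c) \<and> cmod \<gamma> = 1"

end

(* The trace form: with \<beta> = \<alpha> \<alpha>\<^sup>*, both \<beta>^3 / 3 and \<beta>^5 / 5 are integral, so by the
   Frobenius congruence Tr(x \<beta>) is divisible by 15 for every integer x of K.  As the layer matrix is
   unitary, Tr(z \<nu>_k\<^sup>* ) / 15 are the coordinates of z with respect to \<nu>, and they are Gaussian
   integers for every z in I.  This needs no description of the ring of integers of K.

   The determinant: 5 is totally ramified in Q(\<theta>), with \<theta> + 1 of norm -5.  Modulo \<theta> + 1 all
   conjugations act trivially, and a codeword becomes the matrix of multiplication by
   a_0 + a_1 X + a_2 X^2 + a_3 X^3 modulo X^4 - \<i>, where \<i> reduces to \<plusminus>2 in the two residue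
   fields F_5.  Since X^4 - 2 and X^4 + 2 are irreducible over F_5, a vanishing determinant forces all
   layers to be divisible by \<theta> + 1, and infinite descent makes them 0.  A nonzero determinant is a
   nonzero Gaussian integer up to the scaling factor. *)

theory Submission
  imports Defs
begin

subsection \<open>The ring of algebraic integers\<close>

text \<open>The constant 15 and \<beta> belong together: Q(\<theta>) has discriminant 1125 = 3^2 5^3
  and \<beta> has norm 45 = 3^2 5, so the form Tr(x y \<beta>) on the integers of Q(\<theta>) has
  determinant 45 * 1125 = 15^4, as 15 times a unimodular form must. The ideal of \<beta> is the
  product of the primes above 3 (ramification index 2) and 5 (index 4). Hence already \<beta>^2 / 3
  and \<beta>^4 / 5 are integral; the exponents 3 and 5 appear because the Frobenius congruence
  needs p-th powers. The obstacle is that the integers of K are known only as algebraic integers,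
  without coordinates. Divisibility is therefore tested on traces and norms, which land in Z[i], or
  in the explicit order Z[i][\<theta>], which contains the nu_k. No division algebra and no norm
  criterion for \<gamma> is involved. The price of reducing the determinant D directly is that a
  congruence modulo \<theta> + 1 between Gaussian integers becomes one modulo 5 only after taking
  relative norms, which replaces D by D^4; this is harmless in the residue fields above 5.\<close>

lemma algebraic_int_if_int_eigenvalue:
  fixes A :: "int mat" and x :: complex
  assumes A: "A \<in> carrier_mat n n"
    and ev: "eigenvalue (map_mat of_int A) x"
  shows "algebraic_int x"
proof -
  have "poly (char_poly (map_mat of_int A)) x = 0"
    using eigenvalue_root_char_poly[of "map_mat of_int A" n x] A ev by simp
  then have "poly (map_poly of_int (char_poly A)) x = 0"
    by (simp add: of_int_hom.char_poly_hom[OF A])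
  moreover have "Polynomial.coeff (char_poly A) (Polynomial.degree (char_poly A)) = 1"
    using degree_monic_char_poly[OF A] by simp
  ultimately show ?thesis
    unfolding algebraic_int_altdef_ipoly by blast
qed

text \<open>Coefficients are attached to the elements of a set and not to a list of generators, so
  coinciding monomials \<open>x ^ i * y ^ j\<close> need no care later.\<close>

definition int_span :: "complex set \<Rightarrow> complex set" where
  "int_span B = {\<Sum>b\<in>B. of_int (c b) * b | c :: complex \<Rightarrow> int. True}"

lemma int_span_add: "x \<in> int_span B \<Longrightarrow> y \<in> int_span B \<Longrightarrow> x + y \<in> int_span B"
proof -
  assume "x \<in> int_span B" "y \<in> int_span B"
  then obtain c d :: "complex \<Rightarrow> int" where
    "x = (\<Sum>b\<in>B. of_int (c b) * b)" "y = (\<Sum>b\<in>B. of_int (d b) * b)"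
    by (auto simp: int_span_def)
  then have "x + y = (\<Sum>b\<in>B. of_int (c b + d b) * b)"
    by (simp add: sum.distrib algebra_simps)
  then show ?thesis by (auto simp: int_span_def intro!: exI[of _ "\<lambda>b. c b + d b"])
qed

lemma int_span_scale: "x \<in> int_span B \<Longrightarrow> of_int k * x \<in> int_span B"
proof -
  assume "x \<in> int_span B"
  then obtain c :: "complex \<Rightarrow> int" where "x = (\<Sum>b\<in>B. of_int (c b) * b)"
    by (auto simp: int_span_def)
  then have "of_int k * x = (\<Sum>b\<in>B. of_int (k * c b) * b)"
    by (simp add: sum_distrib_left algebra_simps)
  then show ?thesis unfolding int_span_def by (auto intro!: exI[of _ "\<lambda>b. k * c b"])
qed

lemma int_span_0: "0 \<in> int_span B"
  unfolding int_span_def by (auto intro!: exI[of _ "\<lambda>b. 0"])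

lemma int_span_base: "finite B \<Longrightarrow> b \<in> B \<Longrightarrow> b \<in> int_span B"
proof -
  assume "finite B" "b \<in> B"
  define c :: "complex \<Rightarrow> int" where "c = (\<lambda>b'. if b' = b then 1 else 0)"
  have "(\<Sum>b'\<in>B. of_int (c b') * b') = (\<Sum>b'\<in>B. if b' = b then b' else 0)"
    by (rule sum.cong) (auto simp: c_def)
  also have "\<dots> = b" using \<open>finite B\<close> \<open>b \<in> B\<close> by simp
  finally have "b = (\<Sum>b'\<in>B. of_int (c b') * b')" by (rule sym)
  then show ?thesis unfolding int_span_def by blast
qed

lemma int_span_sum: "(\<And>i. i \<in> S \<Longrightarrow> f i \<in> int_span B) \<Longrightarrow> sum f S \<in> int_span B"
  by (induction S rule: infinite_finite_induct) (auto simp: int_span_0 int_span_add)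

lemma int_span_mult:
  assumes "\<And>b. b \<in> B \<Longrightarrow> x * b \<in> int_span B" "s \<in> int_span B"
  shows "x * s \<in> int_span B"
proof -
  obtain c :: "complex \<Rightarrow> int" where s: "s = (\<Sum>b\<in>B. of_int (c b) * b)"
    using assms(2) by (auto simp: int_span_def)
  have "x * s = (\<Sum>b\<in>B. of_int (c b) * (x * b))"
    by (simp add: s sum_distrib_left algebra_simps)
  then show ?thesis by (auto intro!: int_span_sum int_span_scale assms(1))
qed

text \<open>Determinant trick: multiplication by \<open>x\<close> acts on the generators through an
  integer matrix, and the vector of generators is an eigenvector for \<open>x\<close>;
  \<open>b0\<close> makes it nonzero.\<close>

lemma algebraic_int_if_stable_int_span:
  assumes fin: "finite B" and nz: "b0 \<in> B" "b0 \<noteq> 0"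
    and st: "\<And>b. b \<in> B \<Longrightarrow> x * b \<in> int_span B"
  shows "algebraic_int x"
proof -
  obtain bs where bs: "set bs = B" "distinct bs" using finite_distinct_list[OF fin] by blast
  define n where "n = length bs"
  have "\<forall>b\<in>B. \<exists>c :: complex \<Rightarrow> int. x * b = (\<Sum>b'\<in>B. of_int (c b') * b')"
    using st by (auto simp: int_span_def)
  then obtain c :: "complex \<Rightarrow> complex \<Rightarrow> int"
    where c: "\<And>b. b \<in> B \<Longrightarrow> x * b = (\<Sum>b'\<in>B. of_int (c b b') * b')"
    by metis
  define A where "A = mat n n (\<lambda>(i, j). c (bs ! i) (bs ! j))"
  define v where "v = vec n (\<lambda>i. bs ! i)"
  have A: "A \<in> carrier_mat n n" by (simp add: A_def)
  have bij: "bij_betw ((!) bs) {..<n} B"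
    using bij_betw_nth[OF bs(2), of "{..<n}" B] bs(1) by (simp add: n_def)
  have "map_mat of_int A *\<^sub>v v = x \<cdot>\<^sub>v v"
  proof (rule eq_vecI)
    fix i assume "i < dim_vec (x \<cdot>\<^sub>v v)"
    then have i: "i < n" by (simp add: v_def)
    then have iB: "bs ! i \<in> B" using bs(1) by (auto simp: n_def)
    have "(map_mat of_int A *\<^sub>v v) $ i = (\<Sum>j<n. of_int (c (bs ! i) (bs ! j)) * bs ! j)"
      using i by (simp add: A_def v_def scalar_prod_def lessThan_atLeast0)
    also have "\<dots> = (\<Sum>b'\<in>B. of_int (c (bs ! i) b') * b')"
      by (rule sum.reindex_bij_betw[OF bij])
    also have "\<dots> = (x \<cdot>\<^sub>v v) $ i" using c[OF iB] i by (simp add: v_def)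
    finally show "(map_mat of_int A *\<^sub>v v) $ i = (x \<cdot>\<^sub>v v) $ i" .
  qed (simp add: A_def v_def)
  moreover have "v \<noteq> 0\<^sub>v n"
  proof
    assume v0: "v = 0\<^sub>v n"
    obtain i where "i < n" "bs ! i = b0" using nz(1) bs(1) by (auto simp: n_def in_set_conv_nth)
    then show False using v0 nz(2) by (metis index_vec index_zero_vec(1) v_def)
  qed
  ultimately have "eigenvector (map_mat of_int A) v x"
    by (simp add: eigenvector_def A_def v_def)
  then have "eigenvalue (map_mat of_int A) x" by (auto simp: eigenvalue_def)
  then show ?thesis by (rule algebraic_int_if_int_eigenvalue[OF A])
qed

lemma algebraic_int_power_relation:
  assumes "algebraic_int (x :: complex)"
  obtains m :: nat and c :: "nat \<Rightarrow> int" where "m > 0" "x ^ m = (\<Sum>k<m. of_int (c k) * x ^ k)"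
proof -
  obtain p :: "int poly" where p: "poly (map_poly of_int p) x = 0" "Polynomial.coeff p (Polynomial.degree p) = 1"
    using assms by (auto simp: algebraic_int_altdef_ipoly)
  define m where "m = Polynomial.degree p"
  have "poly (map_poly of_int p) x = (\<Sum>k\<le>m. of_int (Polynomial.coeff p k) * x ^ k)"
    by (simp add: poly_altdef m_def)
  also have "\<dots> = (\<Sum>k<m. of_int (Polynomial.coeff p k) * x ^ k) + x ^ m"
    using p(2) by (simp add: m_def lessThan_Suc_atMost[symmetric])
  finally have "(\<Sum>k<m. of_int (Polynomial.coeff p k) * x ^ k) + x ^ m = 0" using p(1) by simp
  then have eq: "x ^ m = (\<Sum>k<m. of_int (- Polynomial.coeff p k) * x ^ k)"
    by (simp add: sum_negf add_eq_0_iff)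
  show ?thesis
  proof (rule that[OF _ eq])
    show "m > 0" using eq by (cases "m = 0") auto
  qed
qed

text \<open>Both \<open>x\<close> and \<open>y\<close>, hence \<open>x + y\<close> and \<open>x y\<close>, stabilise the span of the monomials
  \<open>x\<^sup>i y\<^sup>j\<close> of bounded degree.\<close>

lemma
  assumes "algebraic_int (x :: complex)" "algebraic_int y"
  shows algebraic_int_plus: "algebraic_int (x + y)"
    and algebraic_int_times: "algebraic_int (x * y)"
proof -
  obtain m :: nat and c :: "nat \<Rightarrow> int" where m: "m > 0" "x ^ m = (\<Sum>k<m. of_int (c k) * x ^ k)"
    using algebraic_int_power_relation[OF assms(1)] .
  obtain n :: nat and d :: "nat \<Rightarrow> int" where n: "n > 0" "y ^ n = (\<Sum>k<n. of_int (d k) * y ^ k)"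
    using algebraic_int_power_relation[OF assms(2)] .
  define B where "B = (\<lambda>(i, j). x ^ i * y ^ j) ` ({..<m} \<times> {..<n})"
  have fin: "finite B" by (simp add: B_def)
  have inB: "x ^ i * y ^ j \<in> int_span B" if "i < m" "j < n" for i j
    using that by (intro int_span_base fin) (auto simp: B_def)
  have x: "x * b \<in> int_span B" if "b \<in> B" for b
  proof -
    obtain i j where ij: "i < m" "j < n" "b = x ^ i * y ^ j" using \<open>b \<in> B\<close> by (auto simp: B_def)
    show ?thesis
    proof (cases "Suc i < m")
      case True
      then show ?thesis using inB[of "Suc i" j] ij by (simp add: mult.assoc)
    next
      case False
      then have "m = Suc i" using ij by simp
      then have "x * b = x ^ m * y ^ j" using ij by (simp add: mult.assoc)
      also have "\<dots> = (\<Sum>k<m. of_int (c k) * (x ^ k * y ^ j))"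
        unfolding m(2) by (simp add: sum_distrib_right mult.assoc)
      also have "\<dots> \<in> int_span B" using ij by (intro int_span_sum int_span_scale inB) auto
      finally show ?thesis .
    qed
  qed
  have y: "y * b \<in> int_span B" if "b \<in> B" for b
  proof -
    obtain i j where ij: "i < m" "j < n" "b = x ^ i * y ^ j" using \<open>b \<in> B\<close> by (auto simp: B_def)
    show ?thesis
    proof (cases "Suc j < n")
      case True
      then show ?thesis using inB[of i "Suc j"] ij by (simp add: algebra_simps)
    next
      case False
      then have "n = Suc j" using ij by simp
      then have "y * b = x ^ i * y ^ n" using ij by simp
      also have "\<dots> = (\<Sum>k<n. of_int (d k) * (x ^ i * y ^ k))"
        unfolding n(2) by (simp add: sum_distrib_left algebra_simps)
      also have "\<dots> \<in> int_span B" using ij by (intro int_span_sum int_span_scale inB) auto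
      finally show ?thesis .
    qed
  qed
  have one: "1 \<in> B" using m(1) n(1) by (force simp: B_def)
  show "algebraic_int (x + y)"
    by (rule algebraic_int_if_stable_int_span[OF fin one])
      (auto simp: distrib_right intro: int_span_add x y)
  show "algebraic_int (x * y)"
  proof (rule algebraic_int_if_stable_int_span[OF fin one])
    show "x * y * b \<in> int_span B" if "b \<in> B" for b
      using int_span_mult[OF x y[OF that]] by (simp add: mult.assoc)
  qed simp
qed

lemma algebraic_int_diff:
  "algebraic_int (x :: complex) \<Longrightarrow> algebraic_int y \<Longrightarrow> algebraic_int (x - y)"
  using algebraic_int_plus[of x "- y"] by simp

lemma algebraic_int_power: "algebraic_int (x :: complex) \<Longrightarrow> algebraic_int (x ^ n)"
  by (induction n) (auto intro: algebraic_int_times)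


lemma algebraic_int_of_int: "algebraic_int (of_int k :: complex)"
  by (rule int_imp_algebraic_int) simp

lemma gaussian_algebraic_int: "x \<in> gaussian_ints \<Longrightarrow> algebraic_int x"
  by (auto simp: gaussian_ints_def intro!: algebraic_int_plus algebraic_int_times algebraic_int_of_int)


lemma Re_of_rat [simp]: "Re (of_rat p) = of_rat p" and Im_of_rat [simp]: "Im (of_rat p) = 0"
proof -
  have "of_rat p = complex_of_real (of_rat p)"
    by (cases p) (simp add: of_rat_rat)
  then show "Re (of_rat p) = of_rat p" "Im (of_rat p) = 0"
    by (metis Re_complex_of_real, metis Im_complex_of_real)
qed

lemma cnj_of_rat [simp]: "cnj (of_rat p) = of_rat p"
  by (simp add: complex_eq_iff)

subsection \<open>The field of Gaussian numbers\<close>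

definition gaussian_rats :: "complex set" where
  "gaussian_rats = {of_rat p + of_rat q * \<i> | p q. True}"

lemma gaussian_rats_I: "of_rat p + of_rat q * \<i> \<in> gaussian_rats"
  by (auto simp: gaussian_rats_def)

lemma gaussian_rats_E:
  assumes "x \<in> gaussian_rats" obtains p q where "x = of_rat p + of_rat q * \<i>"
  using assms by (auto simp: gaussian_rats_def)

lemma gaussian_rats_add: "x \<in> gaussian_rats \<Longrightarrow> y \<in> gaussian_rats \<Longrightarrow> x + y \<in> gaussian_rats"
proof -
  assume "x \<in> gaussian_rats" "y \<in> gaussian_rats"
  then obtain a b c d where "x = of_rat a + of_rat b * \<i>" "y = of_rat c + of_rat d * \<i>"
    by (auto simp: gaussian_rats_def)
  then have "x + y = of_rat (a + c) + of_rat (b + d) * \<i>" by (simp add: of_rat_add algebra_simps)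
  then show ?thesis by (metis gaussian_rats_I)
qed

lemma gaussian_rats_mult: "x \<in> gaussian_rats \<Longrightarrow> y \<in> gaussian_rats \<Longrightarrow> x * y \<in> gaussian_rats"
proof -
  assume "x \<in> gaussian_rats" "y \<in> gaussian_rats"
  then obtain a b c d where "x = of_rat a + of_rat b * \<i>" "y = of_rat c + of_rat d * \<i>"
    by (auto simp: gaussian_rats_def)
  then have "x * y = of_rat (a * c - b * d) + of_rat (a * d + b * c) * \<i>"
    by (simp add: of_rat_add of_rat_diff of_rat_mult algebra_simps)
  then show ?thesis by (metis gaussian_rats_I)
qed

lemma gaussian_rats_rat: "of_rat p \<in> gaussian_rats"
  using gaussian_rats_I[of p 0] by simp

lemma gaussian_rats_i: "\<i> \<in> gaussian_rats"
  using gaussian_rats_I[of 0 1] by simp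

lemma gaussian_rats_uminus: "x \<in> gaussian_rats \<Longrightarrow> - x \<in> gaussian_rats"
  using gaussian_rats_mult[OF gaussian_rats_rat[of "-1"]] by simp

lemma gaussian_rats_diff: "x \<in> gaussian_rats \<Longrightarrow> y \<in> gaussian_rats \<Longrightarrow> x - y \<in> gaussian_rats"
  using gaussian_rats_add[OF _ gaussian_rats_uminus] by force

lemma gaussian_rats_inverse: "x \<in> gaussian_rats \<Longrightarrow> inverse x \<in> gaussian_rats"
proof -
  assume "x \<in> gaussian_rats"
  then obtain a b where x: "x = of_rat a + of_rat b * \<i>" by (rule gaussian_rats_E)
  show ?thesis
  proof (cases "x = 0")
    case True
    then show ?thesis using gaussian_rats_rat[of 0] by simp
  next
    case False
    let ?y = "of_rat a - of_rat b * \<i>"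
    have xy: "x * ?y = of_rat (a\<^sup>2 + b\<^sup>2)"
      by (simp add: x of_rat_add of_rat_mult power2_eq_square algebra_simps)
    have "cnj x = ?y" by (simp add: x complex_eq_iff Re_complex_of_real)
    then have "?y \<noteq> 0" using False by (metis complex_cnj_zero_iff)
    then have "inverse x = ?y * inverse (x * ?y)"
      using False by (simp add: field_simps)
    then have "inverse x = ?y * of_rat (inverse (a\<^sup>2 + b\<^sup>2))"
      unfolding xy by (simp add: of_rat_inverse)
    moreover have "?y \<in> gaussian_rats"
      by (intro gaussian_rats_diff gaussian_rats_mult gaussian_rats_rat gaussian_rats_i)
    ultimately show ?thesis by (simp add: gaussian_rats_mult gaussian_rats_rat)
  qed
qed


lemma algebraic_int_rat_imp_int:
  assumes "algebraic_int (of_rat p :: complex)" obtains k where "p = of_int k"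
proof -
  have "(of_rat p :: complex) \<in> \<int>" by (rule rational_algebraic_int_is_int) (use assms in auto)
  then obtain k where "(of_rat p :: complex) = of_int k" by (auto elim: Ints_cases)
  then have "(of_rat p :: complex) = of_rat (of_int k)" by simp
  then show ?thesis using that by (simp only: of_rat_eq_iff)
qed

text \<open>Trace and norm over the rationals are integers, so \<open>2 * p\<close> and
  \<open>2 * q\<close> are integers whose squares sum to a multiple of 4. Squares are 0 or 1 modulo
  4, so both are even.\<close>

lemma algebraic_int_gaussian_rat:
  assumes "x \<in> gaussian_rats" "algebraic_int x"
  shows "x \<in> gaussian_ints"
proof -
  obtain p q where x: "x = of_rat p + of_rat q * \<i>" using assms(1) by (rule gaussian_rats_E)
  have cx: "cnj x = of_rat p - of_rat q * \<i>" by (simp add: x complex_eq_iff)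
  have icx: "algebraic_int (cnj x)" using assms(2) by auto
  have "x + cnj x = of_rat (2 * p)" by (simp add: x cx of_rat_mult)
  then have "algebraic_int (of_rat (2 * p) :: complex)"
    using algebraic_int_plus[OF assms(2) icx] by simp
  then obtain a where a: "2 * p = of_int a" by (rule algebraic_int_rat_imp_int)
  have "(x - cnj x) * (- \<i>) = of_rat (2 * q)" by (simp add: x cx of_rat_mult)
  then have "algebraic_int (of_rat (2 * q) :: complex)"
    using algebraic_int_times[OF algebraic_int_diff[OF assms(2) icx], of "- \<i>"]
    by (metis algebraic_int_ii algebraic_int_minus)
  then obtain b where b: "2 * q = of_int b" by (rule algebraic_int_rat_imp_int)
  have "x * cnj x = of_rat (p * p + q * q)"
    by (simp add: x cx of_rat_mult of_rat_add algebra_simps)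
  then have "algebraic_int (of_rat (p * p + q * q) :: complex)"
    using algebraic_int_times[OF assms(2) icx] by simp
  then obtain n where n: "p * p + q * q = of_int n" by (rule algebraic_int_rat_imp_int)
  have "of_int (a * a + b * b) = (of_int (4 * n) :: rat)"
    unfolding of_int_mult of_int_add a[symmetric] b[symmetric] n[symmetric]
    by (simp add: algebra_simps)
  then have ab: "a * a + b * b = 4 * n" by (simp only: of_int_eq_iff)
  have "even a \<and> even b"
  proof -
    have "(a * a + b * b) mod 4 = 0" by (simp add: ab)
    moreover have "(z * z) mod 4 = (if even z then 0 else 1)" for z :: int
    proof (cases "even z")
      case True then show ?thesis by (auto elim!: evenE)
    next
      case False
      then obtain k where "z = 2 * k + 1" by (auto elim!: oddE)
      then have "z * z = 1 + 4 * (k * k + k)" by (simp add: algebra_simps)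
      then have "z * z mod 4 = 1" by presburger
      then show ?thesis using False by simp
    qed
    ultimately show ?thesis
      using mod_add_eq[of "a * a" 4 "b * b"] by (auto split: if_splits)
  qed
  then obtain a' b' where "a = 2 * a'" "b = 2 * b'" by (auto elim!: evenE)
  then have "p = of_int a'" "q = of_int b'" using a b by auto
  then show ?thesis by (auto simp: x gaussian_ints_def)
qed

lemma gaussian_ints_rats: "x \<in> gaussian_ints \<Longrightarrow> x \<in> gaussian_rats"
  by (auto simp: gaussian_ints_def) (metis gaussian_rats_I of_rat_of_int_eq)

lemma gaussian_ints_iff: "x \<in> gaussian_ints \<longleftrightarrow> x \<in> gaussian_rats \<and> algebraic_int x"
  using algebraic_int_gaussian_rat gaussian_ints_rats gaussian_algebraic_int by blast

lemma gaussian_ints_I: "of_int a + of_int b * \<i> \<in> gaussian_ints"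
  by (auto simp: gaussian_ints_def)

lemma of_int_gaussian_rat_dvd:
  assumes "(of_int a + of_int b * \<i>) / of_int n \<in> gaussian_ints" and "n \<noteq> 0"
  shows "n dvd a" "n dvd b"
proof -
  obtain c d where "(of_int a + of_int b * \<i>) / of_int n = of_int c + of_int d * \<i>"
    using assms(1) by (auto simp: gaussian_ints_def)
  then have "of_int a + of_int b * \<i> = of_int n * (of_int c + of_int d * \<i>)"
    using assms(2) by (simp add: field_simps)
  also have "\<dots> = of_int (n * c) + of_int (n * d) * \<i>" by (simp add: algebra_simps)
  finally have "(of_int a :: real) = of_int (n * c)" "(of_int b :: real) = of_int (n * d)"
    by (simp_all add: complex_eq_iff)
  then show "n dvd a" "n dvd b" unfolding of_int_eq_iff by auto
qed


subsection \<open>The quartic number \<open>2 cos (2\<pi> / 15)\<close>\<close>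

definition theta :: complex where
  "theta = of_real (2 * cos (2 * pi / 15))"

lemma cos_five_times: "cos (5 * x) = 16 * cos x ^ 5 - 20 * cos x ^ 3 + 5 * cos (x :: real)"
proof -
  have "cos (5 * x) + cos x = cos (3 * x + 2 * x) + cos (3 * x - 2 * x)" by simp
  also have "\<dots> = 2 * cos (3 * x) * cos (2 * x)" unfolding cos_add cos_diff by simp
  finally show ?thesis
    unfolding cos_treble_cos cos_double_cos by (simp add: algebra_simps eval_nat_numeral)
qed

lemma theta_pow4: "theta ^ 4 = theta ^ 3 + 4 * theta\<^sup>2 - 4 * theta - 1"
proof -
  define c where "c = 2 * cos (2 * pi / 15)"
  have "cos (5 * (2 * pi / 15)) = - (1 / 2)"
    using cos_120 by (simp add: field_simps)
  then have "c ^ 5 - 5 * c ^ 3 + 5 * c + 1 = 0"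
    unfolding cos_five_times by (simp add: c_def power_mult_distrib)
  \<comment> \<open>The quintic comes from the fivefold angle \<open>2 * pi / 3\<close>; its factor
    \<open>c + 1\<close> belongs to the root -1, which positivity of \<open>c\<close>
    excludes.\<close>
  then have "(c + 1) * (c ^ 4 - c ^ 3 - 4 * c\<^sup>2 + 4 * c + 1) = 0"
    by (simp add: algebra_simps eval_nat_numeral)
  moreover have "c > 0" unfolding c_def by (intro mult_pos_pos cos_gt_zero) auto
  ultimately have "c ^ 4 - c ^ 3 - 4 * c\<^sup>2 + 4 * c + 1 = 0" by simp
  then have "c ^ 4 = c ^ 3 + 4 * c\<^sup>2 - 4 * c - 1" by simp
  then have "complex_of_real (c ^ 4) = complex_of_real (c ^ 3 + 4 * c\<^sup>2 - 4 * c - 1)"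
    by (rule arg_cong)
  then show ?thesis by (simp add: theta_def c_def[symmetric])
qed

lemma Im_theta [simp]: "Im (theta ^ n) = 0"
  unfolding theta_def of_real_power[symmetric] by (rule Im_complex_of_real)

lemma cnj_theta [simp]: "cnj theta = theta"
  by (simp add: theta_def)

lemma theta_algebraic_int: "algebraic_int theta"
proof -
  let ?p = "[:1, 4, -4, -1, 1:] :: int poly"
  have "poly (map_poly of_int ?p) theta = 0"
    using theta_pow4 by (simp add: algebra_simps eval_nat_numeral)
  moreover have "Polynomial.lead_coeff ?p = 1" by simp
  ultimately show ?thesis unfolding algebraic_int_altdef_ipoly by blast
qed

text \<open>These rules reduce every polynomial in \<open>\<theta>\<close> and \<open>\<i>\<close> to degree at most \<open>3\<close> in \<open>\<theta>\<close> and
  \<open>1\<close> in \<open>\<i>\<close>.\<close>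

lemma theta_reduce:
  "theta * (theta * (theta * theta)) = theta * (theta * theta) + 4 * (theta * theta) - 4 * theta - 1"
  "theta * (theta * (theta * (theta * x)))
    = theta * (theta * (theta * x)) + 4 * (theta * (theta * x)) - 4 * (theta * x) - x"
proof -
  show *: "theta * (theta * (theta * theta))
      = theta * (theta * theta) + 4 * (theta * theta) - 4 * theta - 1"
    using theta_pow4 by (simp add: eval_nat_numeral mult.assoc)
  have "theta * (theta * (theta * (theta * x))) = theta * (theta * (theta * theta)) * x"
    by (simp add: mult_ac)
  then show "theta * (theta * (theta * (theta * x)))
    = theta * (theta * (theta * x)) + 4 * (theta * (theta * x)) - 4 * (theta * x) - x"
    unfolding * by (simp add: algebra_simps)
qed

lemma i_reduce: "\<i> * (\<i> * x) = - x"
  by (simp add: mult.assoc[symmetric])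

lemmas theta_simps = algebra_simps eval_nat_numeral theta_reduce i_reduce

lemma theta_shift_pow4: "(theta + 1) ^ 4 = 5 * (theta ^ 3 + 2 * theta\<^sup>2)"
  by (simp add: theta_simps)

text \<open>The cubic factor is the inverse of the unit \<open>theta ^ 3 + 2 * theta\<^sup>2\<close>
  in \<open>theta_shift_pow4\<close>.\<close>

lemma five_theta_shift: "5 = (theta + 1) ^ 4 * (11 - 9 * theta - 2 * theta\<^sup>2 + 2 * theta ^ 3)"
  by (simp add: theta_simps)

section \<open>Linear independence of the powers of theta\<close>

lemmas algebraic_int_intros =
  algebraic_int_plus algebraic_int_times algebraic_int_diff algebraic_int_power
  algebraic_int_of_int theta_algebraic_int

lemma algebraic_int_numeral: "algebraic_int (numeral n :: complex)"
  using algebraic_int_of_int[of "numeral n"] by simp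

lemma algebraic_int_1: "algebraic_int (1 :: complex)"
  using algebraic_int_of_int[of 1] by simp

text \<open>Since \<open>(\<theta> + 1)\<^sup>4\<close> is \<open>5\<close> times a unit, an integer divisible by \<open>\<theta> + 1\<close> is divisible by
  \<open>5\<close>: the Eisenstein criterion for the minimal polynomial of \<open>\<theta> + 1\<close>.\<close>

lemma dvd_of_theta_shift_dvd:
  assumes "of_int p = (theta + 1) * q" "algebraic_int q"
  shows "\<exists>p'. p = 5 * p'"
proof -
  have "of_int (p ^ 4) = (theta + 1) ^ 4 * q ^ 4" using assms(1) by (simp add: power_mult_distrib)
  then have "of_int (p ^ 4) / 5 = (theta ^ 3 + 2 * theta\<^sup>2) * q ^ 4"
    unfolding theta_shift_pow4 by simp
  then have "(of_rat (of_int (p ^ 4) / 5) :: complex) = (theta ^ 3 + 2 * theta\<^sup>2) * q ^ 4"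
    by (simp add: of_rat_divide of_rat_power)
  moreover have "algebraic_int ((theta ^ 3 + 2 * theta\<^sup>2) * q ^ 4)"
    using assms(2) by (intro algebraic_int_intros algebraic_int_numeral)
  ultimately have "algebraic_int (of_rat (of_int (p ^ 4) / 5) :: complex)" by simp
  then obtain k where "of_int (p ^ 4) / 5 = (of_int k :: rat)" by (rule algebraic_int_rat_imp_int)
  then have "(of_int (p ^ 4) :: rat) = of_int (5 * k)" by simp
  then have "5 dvd p ^ 4" by (simp only: of_int_eq_iff) simp
  then have "5 dvd p" by (rule prime_dvd_power_int[rotated]) simp
  then show ?thesis by auto
qed

text \<open>Elimination from the lowest term: the constant coefficient is a multiple of
  \<open>t = theta + 1\<close>, hence of 5. Rewriting 5 as \<open>t ^ 4 * v\<close> lets one factor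
  \<open>t\<close> be cancelled, after which the next coefficient is the constant one.\<close>

lemma theta_independent_int_descent:
  fixes p0 p1 p2 p3 :: int
  assumes "of_int p0 + of_int p1 * (theta + 1) + of_int p2 * (theta + 1)\<^sup>2
    + of_int p3 * (theta + 1) ^ 3 = 0"
  shows "5 dvd p0 \<and> 5 dvd p1 \<and> 5 dvd p2 \<and> 5 dvd p3"
proof -
  define t where "t = theta + 1"
  define v where "v = 11 - 9 * theta - 2 * theta\<^sup>2 + 2 * theta ^ 3"
  have five: "5 = t ^ 4 * v" unfolding t_def v_def by (rule five_theta_shift)
  have t0: "t \<noteq> 0" using five by auto
  have it: "algebraic_int t" unfolding t_def
    by (intro algebraic_int_intros algebraic_int_1)
  have iv: "algebraic_int v" unfolding v_def
    by (intro algebraic_int_intros algebraic_int_numeral)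
  note [intro] = algebraic_int_plus algebraic_int_times algebraic_int_diff algebraic_int_power
    algebraic_int_of_int it iv algebraic_int_minus
  have e0: "of_int p0 + of_int p1 * t + of_int p2 * t\<^sup>2 + of_int p3 * t ^ 3 = 0"
    using assms by (simp add: t_def)
  have "of_int p0 = t * (- of_int p1 - of_int p2 * t - of_int p3 * t\<^sup>2)"
    using e0 by Groebner_Basis.algebra
  then obtain q0 where p0: "p0 = 5 * q0"
    using dvd_of_theta_shift_dvd[folded t_def] by blast
  have "t * (of_int p1 + of_int p2 * t + of_int p3 * t\<^sup>2 + t ^ 3 * v * of_int q0) = 0"
    using e0 five unfolding p0 by (simp del: five) Groebner_Basis.algebra
  then have e1: "of_int p1 + of_int p2 * t + of_int p3 * t\<^sup>2 + t ^ 3 * v * of_int q0 = 0"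
    using t0 by simp
  have "of_int p1 = t * (- of_int p2 - of_int p3 * t - t\<^sup>2 * v * of_int q0)"
    using e1 by Groebner_Basis.algebra
  then obtain q1 where p1: "p1 = 5 * q1"
    using dvd_of_theta_shift_dvd[folded t_def] by blast
  have "t * (of_int p2 + of_int p3 * t + t\<^sup>2 * v * of_int q0 + t ^ 3 * v * of_int q1) = 0"
    using e1 five unfolding p1 by simp Groebner_Basis.algebra
  then have e2: "of_int p2 + of_int p3 * t + t\<^sup>2 * v * of_int q0 + t ^ 3 * v * of_int q1 = 0"
    using t0 by simp
  have "of_int p2 = t * (- of_int p3 - t * v * of_int q0 - t\<^sup>2 * v * of_int q1)"
    using e2 by Groebner_Basis.algebra
  then obtain q2 where p2: "p2 = 5 * q2"
    using dvd_of_theta_shift_dvd[folded t_def] by blast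
  have "t * (of_int p3 + t * v * of_int q0 + t\<^sup>2 * v * of_int q1 + t ^ 3 * v * of_int q2) = 0"
    using e2 five unfolding p2 by simp Groebner_Basis.algebra
  then have e3: "of_int p3 + t * v * of_int q0 + t\<^sup>2 * v * of_int q1 + t ^ 3 * v * of_int q2 = 0"
    using t0 by simp
  have "of_int p3 = t * (- v * of_int q0 - t * v * of_int q1 - t\<^sup>2 * v * of_int q2)"
    using e3 by Groebner_Basis.algebra
  then obtain q3 where p3: "p3 = 5 * q3"
    using dvd_of_theta_shift_dvd[folded t_def] by blast
  show ?thesis by (simp add: p0 p1 p2 p3)
qed

text \<open>Dividing every coefficient by 5 preserves the relation, so a nontrivial relation would
  shrink forever.\<close>

lemma theta_independent_int_shift:
  fixes p0 p1 p2 p3 :: int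
  assumes "of_int p0 + of_int p1 * (theta + 1) + of_int p2 * (theta + 1)\<^sup>2
    + of_int p3 * (theta + 1) ^ 3 = 0"
  shows "p0 = 0 \<and> p1 = 0 \<and> p2 = 0 \<and> p3 = 0"
  using assms
proof (induction "nat (\<bar>p0\<bar> + \<bar>p1\<bar> + \<bar>p2\<bar> + \<bar>p3\<bar>)" arbitrary: p0 p1 p2 p3 rule: less_induct)
  case less
  obtain q0 q1 q2 q3 where q: "p0 = 5 * q0" "p1 = 5 * q1" "p2 = 5 * q2" "p3 = 5 * q3"
    using theta_independent_int_descent[OF less.prems] by (auto elim!: dvdE)
  have "5 * (of_int q0 + of_int q1 * (theta + 1) + of_int q2 * (theta + 1)\<^sup>2
      + of_int q3 * (theta + 1) ^ 3) = 0"
    using less.prems unfolding q by (simp add: distrib_left mult.assoc)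
  then have e: "of_int q0 + of_int q1 * (theta + 1) + of_int q2 * (theta + 1)\<^sup>2
      + of_int q3 * (theta + 1) ^ 3 = 0"
    by (simp only: mult_eq_0_iff) simp
  show ?case
  proof (rule ccontr)
    assume "\<not> ?case"
    then have "q0 \<noteq> 0 \<or> q1 \<noteq> 0 \<or> q2 \<noteq> 0 \<or> q3 \<noteq> 0" by (auto simp: q)
    then have "\<bar>q0\<bar> + \<bar>q1\<bar> + \<bar>q2\<bar> + \<bar>q3\<bar> > 0"
      by (auto intro: add_pos_nonneg add_nonneg_pos)
    moreover have "\<bar>p0\<bar> + \<bar>p1\<bar> + \<bar>p2\<bar> + \<bar>p3\<bar> = 5 * (\<bar>q0\<bar> + \<bar>q1\<bar> + \<bar>q2\<bar> + \<bar>q3\<bar>)"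
      by (simp add: q abs_mult)
    moreover have "nat s < nat t" if "0 < s" "t = 5 * s" for s t :: int using that by simp
    ultimately have "nat (\<bar>q0\<bar> + \<bar>q1\<bar> + \<bar>q2\<bar> + \<bar>q3\<bar>) < nat (\<bar>p0\<bar> + \<bar>p1\<bar> + \<bar>p2\<bar> + \<bar>p3\<bar>)"
      by blast
    from less.hyps[OF this e] \<open>\<not> ?case\<close> show False by (simp add: q)
  qed
qed

lemma theta_independent_int:
  fixes a b c d :: int
  assumes "of_int a + of_int b * theta + of_int c * theta\<^sup>2 + of_int d * theta ^ 3 = 0"
  shows "a = 0 \<and> b = 0 \<and> c = 0 \<and> d = 0"
proof -
  \<comment> \<open>Taylor expansion at -1, that is, substitution of \<open>(theta + 1) - 1\<close>
    for \<open>theta\<close>.\<close>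
  have "of_int (a - b + c - d) + of_int (b - 2 * c + 3 * d) * (theta + 1)
    + of_int (c - 3 * d) * (theta + 1)\<^sup>2 + of_int d * (theta + 1) ^ 3 = 0"
    using assms by (simp add: algebra_simps eval_nat_numeral)
  from theta_independent_int_shift[OF this] show ?thesis by auto
qed

lemma rat_fraction: "\<exists>p q. (x :: rat) = of_int p / of_int q \<and> q > 0"
  using quotient_of_div[of x] quotient_of_denom_pos[of x] by (metis surj_pair)

lemma theta_independent_rat:
  fixes a b c d :: rat
  assumes "of_rat a + of_rat b * theta + of_rat c * theta\<^sup>2 + of_rat d * theta ^ 3 = 0"
  shows "a = 0 \<and> b = 0 \<and> c = 0 \<and> d = 0"
proof -
  obtain a1 a2 b1 b2 c1 c2 d1 d2 where q: "a = of_int a1 / of_int a2" "b = of_int b1 / of_int b2"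
      "c = of_int c1 / of_int c2" "d = of_int d1 / of_int d2"
    and pos: "a2 > 0" "b2 > 0" "c2 > 0" "d2 > 0"
    using rat_fraction[of a] rat_fraction[of b] rat_fraction[of c] rat_fraction[of d] by blast
  have "of_int (a1 * b2 * c2 * d2) + of_int (b1 * a2 * c2 * d2) * theta
     + of_int (c1 * a2 * b2 * d2) * theta\<^sup>2 + of_int (d1 * a2 * b2 * c2) * theta ^ 3
     = of_int (a2 * b2 * c2 * d2)
       * (of_rat a + of_rat b * theta + of_rat c * theta\<^sup>2 + of_rat d * theta ^ 3)"
    using pos unfolding q by (simp add: of_rat_divide distrib_left mult.assoc)
  also have "\<dots> = 0" unfolding assms by simp
  finally have "a1 * b2 * c2 * d2 = 0 \<and> b1 * a2 * c2 * d2 = 0 \<and> c1 * a2 * b2 * d2 = 0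
      \<and> d1 * a2 * b2 * c2 = 0"
    by (rule theta_independent_int)
  then show ?thesis using pos by (auto simp: q)
qed

text \<open>As \<open>theta\<close> is real, real and imaginary parts give two separate rational
  relations.\<close>

lemma theta_independent:
  assumes "a \<in> gaussian_rats" "b \<in> gaussian_rats" "c \<in> gaussian_rats" "d \<in> gaussian_rats"
    and "a + b * theta + c * theta\<^sup>2 + d * theta ^ 3 = 0"
  shows "a = 0 \<and> b = 0 \<and> c = 0 \<and> d = 0"
proof -
  obtain a1 a2 b1 b2 c1 c2 d1 d2 where x: "a = of_rat a1 + of_rat a2 * \<i>"
    "b = of_rat b1 + of_rat b2 * \<i>" "c = of_rat c1 + of_rat c2 * \<i>" "d = of_rat d1 + of_rat d2 * \<i>"
    using assms(1-4) by (auto elim!: gaussian_rats_E)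
  define u where "u = of_rat a1 + of_rat b1 * theta + of_rat c1 * theta\<^sup>2 + of_rat d1 * theta ^ 3"
  define v where "v = of_rat a2 + of_rat b2 * theta + of_rat c2 * theta\<^sup>2 + of_rat d2 * theta ^ 3"
  have uv: "u + v * \<i> = 0" using assms(5) by (simp add: x u_def v_def algebra_simps)
  have "Im u = 0" "Im v = 0"
    using Im_theta[of 1] Im_theta[of 2] Im_theta[of 3] by (simp_all add: u_def v_def)
  with uv have "u = 0" "v = 0" by (simp_all add: complex_eq_iff)
  then show ?thesis
    using theta_independent_rat[of a1 b1 c1 d1] theta_independent_rat[of a2 b2 c2 d2]
    by (simp add: x u_def v_def)
qed


subsection \<open>The cyclic extension\<close>

text \<open>The evaluation point is a parameter, so that conjugation keeps the coordinates and only
  replaces \<open>theta\<close> by \<open>theta\<^sup>2 - 2\<close>.\<close>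

definition cubic :: "complex \<Rightarrow> complex \<Rightarrow> complex \<Rightarrow> complex \<Rightarrow> complex \<Rightarrow> complex" where
  "cubic t a b c d = a + b * t + c * t\<^sup>2 + d * t ^ 3"

definition theta_field :: "complex set" where
  "theta_field = {cubic theta a b c d | a b c d.
     a \<in> gaussian_rats \<and> b \<in> gaussian_rats \<and> c \<in> gaussian_rats \<and> d \<in> gaussian_rats}"

text \<open>The conjugation \<open>\<theta> \<mapsto> \<theta>\<^sup>2 - 2\<close> over \<open>\<rat>(\<i>)\<close>; unspecified outside \<^const>\<open>theta_field\<close>.\<close>

definition conj_map :: "complex \<Rightarrow> complex" where
  "conj_map x = (THE y. \<exists>a\<in>gaussian_rats. \<exists>b\<in>gaussian_rats. \<exists>c\<in>gaussian_rats. \<exists>d\<in>gaussian_rats.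
     x = cubic theta a b c d \<and> y = cubic (theta\<^sup>2 - 2) a b c d)"

lemma theta_field_I:
  "a \<in> gaussian_rats \<Longrightarrow> b \<in> gaussian_rats \<Longrightarrow> c \<in> gaussian_rats \<Longrightarrow> d \<in> gaussian_rats \<Longrightarrow>
     cubic theta a b c d \<in> theta_field"
  by (auto simp: theta_field_def)

lemma theta_field_E:
  assumes "x \<in> theta_field"
  obtains a b c d where "x = cubic theta a b c d"
    "a \<in> gaussian_rats" "b \<in> gaussian_rats" "c \<in> gaussian_rats" "d \<in> gaussian_rats"
  using assms by (auto simp: theta_field_def)

lemma cubic_theta_inject:
  assumes "a \<in> gaussian_rats" "b \<in> gaussian_rats" "c \<in> gaussian_rats" "d \<in> gaussian_rats"
    and "a' \<in> gaussian_rats" "b' \<in> gaussian_rats" "c' \<in> gaussian_rats" "d' \<in> gaussian_rats"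
    and "cubic theta a b c d = cubic theta a' b' c' d'"
  shows "a = a' \<and> b = b' \<and> c = c' \<and> d = d'"
proof -
  have "(a - a') + (b - b') * theta + (c - c') * theta\<^sup>2 + (d - d') * theta ^ 3 = 0"
    using assms(9) by (simp add: cubic_def algebra_simps)
  from theta_independent[OF _ _ _ _ this] assms(1-8) show ?thesis
    by (simp add: gaussian_rats_diff)
qed

lemma conj_map_cubic:
  assumes "a \<in> gaussian_rats" "b \<in> gaussian_rats" "c \<in> gaussian_rats" "d \<in> gaussian_rats"
  shows "conj_map (cubic theta a b c d) = cubic (theta\<^sup>2 - 2) a b c d"
  unfolding conj_map_def
proof (rule the_equality)
  show "\<exists>a'\<in>gaussian_rats. \<exists>b'\<in>gaussian_rats. \<exists>c'\<in>gaussian_rats. \<exists>d'\<in>gaussian_rats.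
     cubic theta a b c d = cubic theta a' b' c' d'
     \<and> cubic (theta\<^sup>2 - 2) a b c d = cubic (theta\<^sup>2 - 2) a' b' c' d'"
    using assms by blast
next
  fix y
  assume "\<exists>a'\<in>gaussian_rats. \<exists>b'\<in>gaussian_rats. \<exists>c'\<in>gaussian_rats. \<exists>d'\<in>gaussian_rats.
     cubic theta a b c d = cubic theta a' b' c' d' \<and> y = cubic (theta\<^sup>2 - 2) a' b' c' d'"
  then show "y = cubic (theta\<^sup>2 - 2) a b c d"
    using cubic_theta_inject[OF assms] by metis
qed

text \<open>The coordinates of a product depend on the quartic relation and not on the chosen root
  \<open>t\<close>. Using the formula at \<open>theta\<close> and at its conjugate makes
  \<open>conj_map\<close> multiplicative.\<close>

lemma cubic_mult:
  assumes "t ^ 4 = t ^ 3 + 4 * t\<^sup>2 - 4 * t - 1"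
  shows "cubic t a b c d * cubic t a' b' c' d' =
    cubic t
      (a * a' - (b * d' + c * c' + d * b') - (c * d' + d * c') - 5 * (d * d'))
      (a * b' + b * a' - 4 * (b * d' + c * c' + d * b') - 5 * (c * d' + d * c') - 21 * (d * d'))
      (a * c' + b * b' + c * a' + 4 * (b * d' + c * c' + d * b') + 15 * (d * d'))
      (a * d' + b * c' + c * b' + d * a' + (b * d' + c * c' + d * b') + 5 * (c * d' + d * c')
        + 5 * (d * d'))"
proof -
  have p5: "t ^ 5 = 5 * t ^ 3 - 5 * t - 1"
  proof -
    have "t ^ 5 = t ^ 4 * t" by (simp add: eval_nat_numeral)
    also have "\<dots> = (t ^ 3 + 4 * t\<^sup>2 - 4 * t - 1) * t" unfolding assms ..
    also have "\<dots> = t ^ 4 + 4 * t ^ 3 - 4 * t\<^sup>2 - t"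
      by (simp add: algebra_simps eval_nat_numeral)
    finally show ?thesis unfolding assms by (simp add: algebra_simps)
  qed
  have p6: "t ^ 6 = 5 * t ^ 3 + 15 * t\<^sup>2 - 21 * t - 5"
  proof -
    have "t ^ 6 = t ^ 5 * t" by (simp add: eval_nat_numeral)
    also have "\<dots> = 5 * t ^ 4 - 5 * t\<^sup>2 - t"
      unfolding p5 by (simp add: algebra_simps eval_nat_numeral)
    finally show ?thesis unfolding assms by (simp add: algebra_simps)
  qed
  have "cubic t a b c d * cubic t a' b' c' d'
    = a * a' + (a * b' + b * a') * t + (a * c' + b * b' + c * a') * t\<^sup>2
      + (a * d' + b * c' + c * b' + d * a') * t ^ 3 + (b * d' + c * c' + d * b') * t ^ 4
      + (c * d' + d * c') * t ^ 5 + (d * d') * t ^ 6"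
    by (simp add: cubic_def algebra_simps eval_nat_numeral)
  then show ?thesis unfolding assms p5 p6 by (simp add: cubic_def algebra_simps)
qed

lemma cubic_add: "cubic t a b c d + cubic t a' b' c' d' = cubic t (a + a') (b + b') (c + c') (d + d')"
  by (simp add: cubic_def algebra_simps)

lemma conj_theta_pow4:
  "(theta\<^sup>2 - 2) ^ 4 = (theta\<^sup>2 - 2) ^ 3 + 4 * (theta\<^sup>2 - 2)\<^sup>2 - 4 * (theta\<^sup>2 - 2) - 1"
  by (simp add: theta_simps)

lemma gaussian_rats_numeral: "numeral n \<in> gaussian_rats"
  using gaussian_rats_rat[of "numeral n"] by simp

lemma gaussian_rats_0: "0 \<in> gaussian_rats" and gaussian_rats_1: "1 \<in> gaussian_rats"
  using gaussian_rats_rat[of 0] gaussian_rats_rat[of 1] by simp_all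

lemmas gaussian_rats_intros =
  gaussian_rats_add gaussian_rats_diff gaussian_rats_mult gaussian_rats_uminus gaussian_rats_i
  gaussian_rats_numeral gaussian_rats_0 gaussian_rats_1

lemma theta_field_add: "x \<in> theta_field \<Longrightarrow> y \<in> theta_field \<Longrightarrow> x + y \<in> theta_field"
  by (elim theta_field_E) (simp add: cubic_add theta_field_I gaussian_rats_add)

lemma theta_field_mult: "x \<in> theta_field \<Longrightarrow> y \<in> theta_field \<Longrightarrow> x * y \<in> theta_field"
  by (elim theta_field_E)
    (simp add: cubic_mult[OF theta_pow4] theta_field_I gaussian_rats_intros)

lemma theta_field_gaussian_rats: "x \<in> gaussian_rats \<Longrightarrow> x \<in> theta_field"
  using theta_field_I[of x 0 0 0] by (simp add: cubic_def gaussian_rats_0)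

lemma theta_field_theta: "theta \<in> theta_field"
  using theta_field_I[of 0 1 0 0] by (simp add: cubic_def gaussian_rats_0 gaussian_rats_1)

lemma theta_field_uminus: "x \<in> theta_field \<Longrightarrow> - x \<in> theta_field"
  using theta_field_mult[OF theta_field_gaussian_rats[OF gaussian_rats_uminus[OF gaussian_rats_1]]]
  by simp

lemma theta_field_diff: "x \<in> theta_field \<Longrightarrow> y \<in> theta_field \<Longrightarrow> x - y \<in> theta_field"
  using theta_field_add[OF _ theta_field_uminus] by force

lemma theta_field_power: "x \<in> theta_field \<Longrightarrow> x ^ n \<in> theta_field"
  by (induction n) (auto intro: theta_field_mult theta_field_gaussian_rats gaussian_rats_1)

lemma conj_map_add:
  "x \<in> theta_field \<Longrightarrow> y \<in> theta_field \<Longrightarrow> conj_map (x + y) = conj_map x + conj_map y"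
  by (elim theta_field_E) (simp add: cubic_add conj_map_cubic gaussian_rats_add)

lemma conj_map_mult:
  "x \<in> theta_field \<Longrightarrow> y \<in> theta_field \<Longrightarrow> conj_map (x * y) = conj_map x * conj_map y"
  by (elim theta_field_E)
    (simp add: cubic_mult[OF theta_pow4] cubic_mult[OF conj_theta_pow4] conj_map_cubic
      gaussian_rats_intros)

lemma conj_map_gaussian_rats: "x \<in> gaussian_rats \<Longrightarrow> conj_map x = x"
  using conj_map_cubic[of x 0 0 0] by (simp add: cubic_def gaussian_rats_0)

lemma conj_map_theta: "conj_map theta = theta\<^sup>2 - 2"
  using conj_map_cubic[of 0 1 0 0] by (simp add: cubic_def gaussian_rats_0 gaussian_rats_1)

lemma conj_map_uminus: "x \<in> theta_field \<Longrightarrow> conj_map (- x) = - conj_map x"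
  using conj_map_mult[OF theta_field_gaussian_rats[OF gaussian_rats_uminus[OF gaussian_rats_1]]]
    conj_map_gaussian_rats[OF gaussian_rats_uminus[OF gaussian_rats_1]]
  by simp

lemma conj_map_diff:
  "x \<in> theta_field \<Longrightarrow> y \<in> theta_field \<Longrightarrow> conj_map (x - y) = conj_map x - conj_map y"
  using conj_map_add[OF _ theta_field_uminus] by (force simp: conj_map_uminus)

lemma cubic_conj_theta:
  "cubic (theta\<^sup>2 - 2) a b c d
    = cubic theta (a - 2 * b + 3 * c - 7 * d) (3 * d - 4 * c) (b + 3 * d) (c - d)"
  by (simp add: cubic_def theta_simps)

lemma conj_map_coords:
  assumes "a \<in> gaussian_rats" "b \<in> gaussian_rats" "c \<in> gaussian_rats" "d \<in> gaussian_rats"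
  shows "conj_map (cubic theta a b c d)
    = cubic theta (a - 2 * b + 3 * c - 7 * d) (3 * d - 4 * c) (b + 3 * d) (c - d)"
  by (simp add: conj_map_cubic assms cubic_conj_theta)

lemma conj_map_closed: "x \<in> theta_field \<Longrightarrow> conj_map x \<in> theta_field"
  by (elim theta_field_E) (simp add: conj_map_coords theta_field_I gaussian_rats_intros)

lemma funpow_conj_map_closed: "x \<in> theta_field \<Longrightarrow> (conj_map ^^ k) x \<in> theta_field"
  by (induction k) (auto intro: conj_map_closed)

lemma conj_map_order_4:
  assumes "x \<in> theta_field"
  shows "conj_map (conj_map (conj_map (conj_map x))) = x"
proof -
  obtain a b c d where x: "x = cubic theta a b c d"
    and Q: "a \<in> gaussian_rats" "b \<in> gaussian_rats" "c \<in> gaussian_rats" "d \<in> gaussian_rats"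
    using assms by (rule theta_field_E)
  show ?thesis
    unfolding x by (simp add: conj_map_coords gaussian_rats_intros Q)
qed

text \<open>Comparing coordinates gives c = 2d, b = -5d and then c = b + 3d = -2d, so only the
  constant coordinate remains.\<close>

lemma conj_map_fixed:
  assumes "x \<in> theta_field" "conj_map x = x"
  shows "x \<in> gaussian_rats"
proof -
  obtain a b c d where x: "x = cubic theta a b c d"
    and Q: "a \<in> gaussian_rats" "b \<in> gaussian_rats" "c \<in> gaussian_rats" "d \<in> gaussian_rats"
    using assms(1) by (rule theta_field_E)
  have "cubic theta (a - 2 * b + 3 * c - 7 * d) (3 * d - 4 * c) (b + 3 * d) (c - d)
    = cubic theta a b c d"
    using assms(2) by (simp add: x conj_map_coords Q)
  then have "a - 2 * b + 3 * c - 7 * d = a \<and> 3 * d - 4 * c = b \<and> b + 3 * d = c \<and> c - d = d"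
    by (intro cubic_theta_inject) (use Q in \<open>auto intro!: gaussian_rats_intros\<close>)
  then have c: "c = 2 * d" "b = 3 * d - 4 * c" "b + 3 * d = c" by auto
  then have "d = 0" by simp
  with c show ?thesis using Q(1) by (simp add: x cubic_def)
qed

section \<open>Relative norm and trace down to Q(i)\<close>

definition rel_norm :: "complex \<Rightarrow> complex" where
  "rel_norm x = x * conj_map x * conj_map (conj_map x) * conj_map (conj_map (conj_map x))"

definition rel_trace :: "complex \<Rightarrow> complex" where
  "rel_trace x = x + conj_map x + conj_map (conj_map x) + conj_map (conj_map (conj_map x))"

lemma conj_map_eq_0_iff: "x \<in> theta_field \<Longrightarrow> conj_map x = 0 \<longleftrightarrow> x = 0"
  using conj_map_order_4[of x] conj_map_gaussian_rats[OF gaussian_rats_0] by auto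

text \<open>\<open>conj_map\<close> permutes the four factors cyclically, its fourth power being the
  identity.\<close>

lemma rel_norm_gaussian_rats: "x \<in> theta_field \<Longrightarrow> rel_norm x \<in> gaussian_rats"
  unfolding rel_norm_def
  by (rule conj_map_fixed)
    (simp_all add: theta_field_mult conj_map_mult conj_map_closed conj_map_order_4 mult_ac)

lemma rel_trace_gaussian_rats: "x \<in> theta_field \<Longrightarrow> rel_trace x \<in> gaussian_rats"
  unfolding rel_trace_def
  by (rule conj_map_fixed)
    (simp_all add: theta_field_add conj_map_add conj_map_closed conj_map_order_4 add_ac)

lemma rel_norm_eq_0_iff: "x \<in> theta_field \<Longrightarrow> rel_norm x = 0 \<longleftrightarrow> x = 0"
  by (simp add: rel_norm_def conj_map_eq_0_iff conj_map_closed)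

lemma rel_norm_mult:
  "x \<in> theta_field \<Longrightarrow> y \<in> theta_field \<Longrightarrow> rel_norm (x * y) = rel_norm x * rel_norm y"
  by (simp add: rel_norm_def conj_map_mult conj_map_closed mult_ac)

text \<open>The product of the three other conjugates divided by the relative norm is the inverse,
  which reduces the claim to inverses in Q(i).\<close>

lemma theta_field_inverse:
  assumes "x \<in> theta_field" shows "inverse x \<in> theta_field"
proof (cases "x = 0")
  case False
  define y where "y = conj_map x * conj_map (conj_map x) * conj_map (conj_map (conj_map x))"
  have "rel_norm x = x * y" by (simp add: rel_norm_def y_def mult_ac)
  moreover have "rel_norm x \<noteq> 0" using False assms by (simp add: rel_norm_eq_0_iff)
  ultimately have "inverse x = y * inverse (rel_norm x)" using False by (simp add: field_simps)
  moreover have "y \<in> theta_field"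
    using assms unfolding y_def by (intro theta_field_mult conj_map_closed)
  ultimately show ?thesis
    using assms
    by (simp add: theta_field_mult theta_field_gaussian_rats gaussian_rats_inverse rel_norm_gaussian_rats)
qed (simp add: theta_field_gaussian_rats gaussian_rats_0)


subsection \<open>Subfields of the complex numbers\<close>

lemma complex_field_simps [simp]:
  "carrier complex_field = UNIV" "monoid.mult complex_field = (*)" "one complex_field = 1"
  "ring.zero complex_field = 0" "ring.add complex_field = (+)"
  by (auto simp: ring_of_type_algebra_def fun_eq_iff)

lemma complex_field_field: "field complex_field"
  by (rule field_from_type_algebra)

lemma complex_field_minus: "a_inv complex_field x = - x"
proof -
  interpret field complex_field by (rule complex_field_field)
  show ?thesis by (rule minus_equality) simp_all
qed

lemma complex_field_inverse: "x \<noteq> 0 \<Longrightarrow> m_inv complex_field x = inverse x"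
proof -
  assume "x \<noteq> 0"
  interpret field complex_field by (rule complex_field_field)
  show ?thesis by (rule comm_inv_char) (use \<open>x \<noteq> 0\<close> in auto)
qed

lemma complex_subfieldI:
  assumes "1 \<in> S" "\<And>x. x \<in> S \<Longrightarrow> - x \<in> S" "\<And>x y. x \<in> S \<Longrightarrow> y \<in> S \<Longrightarrow> x + y \<in> S"
    "\<And>x y. x \<in> S \<Longrightarrow> y \<in> S \<Longrightarrow> x * y \<in> S" "\<And>x. x \<in> S \<Longrightarrow> inverse x \<in> S"
  shows "subfield S complex_field"
proof -
  interpret field complex_field by (rule complex_field_field)
  have "subring S complex_field"
    by (rule subringI) (use assms in \<open>auto simp: complex_field_minus\<close>)
  then show ?thesis
    by (rule subfieldI') (use assms in \<open>auto simp: complex_field_inverse\<close>)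
qed

lemma complex_subfieldD:
  assumes "subfield S complex_field"
  shows "0 \<in> S" "1 \<in> S" "x \<in> S \<Longrightarrow> - x \<in> S" "x \<in> S \<Longrightarrow> y \<in> S \<Longrightarrow> x + y \<in> S"
    "x \<in> S \<Longrightarrow> y \<in> S \<Longrightarrow> x * y \<in> S" "x \<in> S \<Longrightarrow> inverse x \<in> S"
proof -
  interpret field complex_field by (rule complex_field_field)
  note sub = subringE[OF subfieldE(1)[OF assms]]
  show *: "0 \<in> S" "1 \<in> S" "x \<in> S \<Longrightarrow> - x \<in> S" "x \<in> S \<Longrightarrow> y \<in> S \<Longrightarrow> x + y \<in> S"
    "x \<in> S \<Longrightarrow> y \<in> S \<Longrightarrow> x * y \<in> S"
    using sub(2,3,5,6,7) by (auto simp: complex_field_minus)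
  show "inverse x \<in> S" if "x \<in> S"
  proof (cases "x = 0")
    case False
    then have "m_inv complex_field x \<in> S" using subfield_m_inv(1)[OF assms, of x] that by simp
    then show ?thesis using False by (simp add: complex_field_inverse)
  qed (use * in auto)
qed

lemma of_rat_in_subfield:
  assumes "subfield S complex_field"
  shows "of_rat q \<in> S"
proof -
  note S = complex_subfieldD[OF assms]
  have nat: "of_nat n \<in> S" for n by (induction n) (auto intro: S)
  have int: "of_int k \<in> S" for k by (cases k) (use nat S(3) in \<open>auto simp del: of_nat_Suc\<close>)
  obtain a b where q: "q = of_int a / of_int b" using rat_fraction by blast
  have "of_rat q = of_int a * inverse (of_int b :: complex)"
    by (simp add: q divide_inverse of_rat_mult of_rat_inverse)
  then show ?thesis using S(5,6) int by simp
qed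

lemma adjoin_subfield: "subfield (adjoin S) complex_field"
  unfolding adjoin_def by (rule field.generate_field_is_subfield[OF complex_field_field]) simp

lemma adjoin_incl: "x \<in> S \<Longrightarrow> x \<in> adjoin S"
  unfolding adjoin_def by (rule generate_field.incl)

lemma adjoin_least: "subfield E complex_field \<Longrightarrow> S \<subseteq> E \<Longrightarrow> adjoin S \<subseteq> E"
  unfolding adjoin_def by (rule field.generate_field_min_subfield1[OF complex_field_field]) auto

lemma gaussian_rats_subfield: "subfield gaussian_rats complex_field"
  by (rule complex_subfieldI) (auto intro: gaussian_rats_intros gaussian_rats_inverse)

lemma theta_field_subfield: "subfield theta_field complex_field"
  by (rule complex_subfieldI)
    (auto intro: theta_field_gaussian_rats gaussian_rats_1 theta_field_uminus theta_field_add
      theta_field_mult theta_field_inverse)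

lemma adjoin_i: "adjoin {\<i>} = gaussian_rats"
proof
  show "adjoin {\<i>} \<subseteq> gaussian_rats"
    by (rule adjoin_least[OF gaussian_rats_subfield]) (auto intro: gaussian_rats_i)
  note A = complex_subfieldD[OF adjoin_subfield[of "{\<i>}"]]
  have "of_rat p + of_rat q * \<i> \<in> adjoin {\<i>}" for p q
    by (intro A(4,5) of_rat_in_subfield[OF adjoin_subfield] adjoin_incl) simp
  then show "gaussian_rats \<subseteq> adjoin {\<i>}" by (auto elim!: gaussian_rats_E)
qed

lemma adjoin_i_theta: "adjoin {\<i>, theta} = theta_field"
proof
  show "adjoin {\<i>, theta} \<subseteq> theta_field"
    by (rule adjoin_least[OF theta_field_subfield])
      (auto intro: theta_field_theta theta_field_gaussian_rats gaussian_rats_i)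
  note A = complex_subfieldD[OF adjoin_subfield[of "{\<i>, theta}"]]
  have i: "\<i> \<in> adjoin {\<i>, theta}" and t: "theta \<in> adjoin {\<i>, theta}"
    by (auto intro: adjoin_incl)
  have "gaussian_rats \<subseteq> adjoin {\<i>, theta}"
    unfolding adjoin_i[symmetric] by (rule adjoin_least[OF adjoin_subfield]) (use i in auto)
  then show "theta_field \<subseteq> adjoin {\<i>, theta}"
    by (auto elim!: theta_field_E simp: cubic_def eval_nat_numeral intro!: A(2,4,5) t)
qed

text \<open>A chain of line extensions by 1, \<open>theta\<close>, \<open>theta\<^sup>2\<close>,
  \<open>theta ^ 3\<close>; uniqueness of coordinates shows that each new vector lies outside the
  span so far.\<close>

lemma dimension_theta_field: "ring.dimension complex_field 4 gaussian_rats theta_field"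
proof -
  interpret field complex_field by (rule complex_field_field)
  have ext: "line_extension gaussian_rats v E = {k * v + e | k e. k \<in> gaussian_rats \<and> e \<in> E}" for v E
    unfolding line_extension_def set_add_def' r_coset_def by force
  define V1 where "V1 = {cubic theta a 0 0 0 | a. a \<in> gaussian_rats}"
  define V2 where "V2 = {cubic theta a b 0 0 | a b. a \<in> gaussian_rats \<and> b \<in> gaussian_rats}"
  define V3 where "V3 = {cubic theta a b c 0 | a b c.
    a \<in> gaussian_rats \<and> b \<in> gaussian_rats \<and> c \<in> gaussian_rats}"
  note [simp] = gaussian_rats_0 gaussian_rats_1
  have notin: "cubic theta 0 b c d \<noteq> cubic theta a' b' c' d'"
    if "b \<noteq> b' \<or> c \<noteq> c' \<or> d \<noteq> d'" "b \<in> gaussian_rats" "c \<in> gaussian_rats" "d \<in> gaussian_rats"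
      "a' \<in> gaussian_rats" "b' \<in> gaussian_rats" "c' \<in> gaussian_rats" "d' \<in> gaussian_rats"
    for a' b b' c c' d d'
    using cubic_theta_inject[of 0 b c d a' b' c' d'] that by auto
  have "dimension 0 gaussian_rats {0}" using zero_dim by simp
  then have "dimension 1 gaussian_rats (line_extension gaussian_rats 1 {0})"
    using Suc_dim[of 1 "{0}" 0] by simp
  also have "line_extension gaussian_rats 1 {0} = V1"
    unfolding ext V1_def by (auto simp: cubic_def)
  finally have d: "dimension 1 gaussian_rats V1" .
  have "cubic theta 0 1 0 0 \<notin> V1"
    using notin[of 1 0 0 0 0 0] by (auto simp: V1_def)
  then have "theta \<notin> V1" by (simp add: cubic_def)
  then have "dimension 2 gaussian_rats (line_extension gaussian_rats theta V1)"
    using Suc_dim[OF _ _ d, of "theta"] by (simp add: eval_nat_numeral)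
  also have "line_extension gaussian_rats theta V1 = V2"
    unfolding ext V1_def V2_def by (force simp: cubic_def)
  finally have d: "dimension 2 gaussian_rats V2" .
  have "cubic theta 0 0 1 0 \<notin> V2"
    using notin[of 0 _ 1 0 0 0] by (auto simp: V2_def)
  then have "theta\<^sup>2 \<notin> V2" by (simp add: cubic_def)
  then have "dimension 3 gaussian_rats (line_extension gaussian_rats (theta\<^sup>2) V2)"
    using Suc_dim[OF _ _ d, of "theta\<^sup>2"] by (simp add: eval_nat_numeral)
  also have "line_extension gaussian_rats (theta\<^sup>2) V2 = V3"
    unfolding ext V2_def V3_def by (force simp: cubic_def)
  finally have d: "dimension 3 gaussian_rats V3" .
  have "cubic theta 0 0 0 1 \<notin> V3"
    using notin[of 0 _ 0 _ 1 0] by (auto simp: V3_def)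
  then have "theta ^ 3 \<notin> V3" by (simp add: cubic_def)
  then have "dimension 4 gaussian_rats (line_extension gaussian_rats (theta ^ 3) V3)"
    using Suc_dim[OF _ _ d, of "theta ^ 3"] by (simp add: eval_nat_numeral)
  also have "line_extension gaussian_rats (theta ^ 3) V3 = theta_field"
  proof
    show "line_extension gaussian_rats (theta ^ 3) V3 \<subseteq> theta_field"
    proof
      fix x assume "x \<in> line_extension gaussian_rats (theta ^ 3) V3"
      then obtain d a b c where "x = d * theta ^ 3 + cubic theta a b c 0"
        "a \<in> gaussian_rats" "b \<in> gaussian_rats" "c \<in> gaussian_rats" "d \<in> gaussian_rats"
        unfolding ext V3_def by blast
      then show "x \<in> theta_field" using theta_field_I[of a b c d] by (simp add: cubic_def add_ac)
    qed
    show "theta_field \<subseteq> line_extension gaussian_rats (theta ^ 3) V3"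
    proof
      fix x assume "x \<in> theta_field"
      then obtain a b c d where "x = d * theta ^ 3 + cubic theta a b c 0"
        "a \<in> gaussian_rats" "b \<in> gaussian_rats" "c \<in> gaussian_rats" "d \<in> gaussian_rats"
        by (auto elim!: theta_field_E simp: cubic_def add_ac)
      then show "x \<in> line_extension gaussian_rats (theta ^ 3) V3" unfolding ext V3_def by blast
    qed
  qed
  finally show ?thesis .
qed


subsection \<open>The Galois group\<close>

lemma galois_group_iff:
  "\<tau> \<in> carrier (galois_group K F) \<longleftrightarrow> \<tau> \<in> Bij K \<and>
     (\<forall>x\<in>K. \<forall>y\<in>K. \<tau> (x * y) = \<tau> x * \<tau> y) \<and> (\<forall>x\<in>K. \<forall>y\<in>K. \<tau> (x + y) = \<tau> x + \<tau> y) \<and>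
     \<tau> 1 = 1 \<and> (\<forall>x\<in>F. \<tau> x = x)"
  by (auto simp: galois_group_def BijGroup_def Ring.ring_hom_def dest: Bij_imp_funcset)

lemma galois_group_mult:
  assumes "\<sigma> \<in> carrier (galois_group K F)" "\<tau> \<in> carrier (galois_group K F)"
  shows "\<sigma> \<otimes>\<^bsub>galois_group K F\<^esub> \<tau> = compose K \<sigma> \<tau>"
  using assms by (simp add: galois_group_def BijGroup_def)

lemma galois_group_one: "\<one>\<^bsub>galois_group K F\<^esub> = (\<lambda>x\<in>K. x)"
  by (simp add: galois_group_def BijGroup_def)

lemma galois_group_group:
  assumes "subfield K complex_field" "F \<subseteq> K"
  shows "group (galois_group K F)"
proof -
  define H where "H = carrier (galois_group K F)"
  note K = complex_subfieldD[OF assms(1)]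
  have "subgroup H (BijGroup K)"
  proof (rule subgroup.intro)
    show "H \<subseteq> carrier (BijGroup K)" by (auto simp: H_def galois_group_iff BijGroup_def)
    show "\<one>\<^bsub>BijGroup K\<^esub> \<in> H"
      using assms(2) by (auto simp: H_def galois_group_iff BijGroup_def id_Bij K)
  next
    fix f g assume fg: "f \<in> H" "g \<in> H"
    then have B: "f \<in> Bij K" "g \<in> Bij K" by (auto simp: H_def galois_group_iff)
    have gK: "g x \<in> K" if "x \<in> K" for x using Bij_imp_funcset[OF B(2)] that by auto
    have "f \<otimes>\<^bsub>BijGroup K\<^esub> g = compose K f g" using B by (simp add: BijGroup_def)
    moreover have "compose K f g \<in> H"
      using fg assms(2) unfolding H_def galois_group_iff
      by (auto simp: compose_Bij compose_eq K gK subset_iff)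
    ultimately show "f \<otimes>\<^bsub>BijGroup K\<^esub> g \<in> H" by simp
  next
    fix f assume f: "f \<in> H"
    then have B: "f \<in> Bij K" by (auto simp: H_def galois_group_iff)
    then have inj: "inj_on f K" by (auto simp: Bij_def bij_betw_def)
    have "inv_into K f (x * y) = inv_into K f x * inv_into K f y" if "x \<in> K" "y \<in> K" for x y
      by (rule Bij_inv_into_lemma[of K f "(*)"]) (use f B K that in \<open>auto simp: H_def galois_group_iff\<close>)
    moreover have "inv_into K f (x + y) = inv_into K f x + inv_into K f y"
      if "x \<in> K" "y \<in> K" for x y
      by (rule Bij_inv_into_lemma[of K f "(+)"]) (use f B K that in \<open>auto simp: H_def galois_group_iff\<close>)
    moreover have "inv_into K f x = x" if "x \<in> insert 1 F" for x
      using inv_into_f_f[OF inj, of x] f that assms(2) K(2) by (auto simp: H_def galois_group_iff)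
    ultimately have "(\<lambda>x\<in>K. inv_into K f x) \<in> H"
      unfolding H_def galois_group_iff using restrict_inv_into_Bij[OF B] K assms(2) by auto
    then show "inv\<^bsub>BijGroup K\<^esub> f \<in> H" by (simp only: inv_BijGroup[OF B])
  qed
  then have "group (BijGroup K\<lparr>carrier := H\<rparr>)"
    by (rule subgroup.subgroup_is_group) (rule group_BijGroup)
  moreover have "galois_group K F = BijGroup K\<lparr>carrier := H\<rparr>"
    by (simp add: galois_group_def H_def)
  ultimately show ?thesis by simp
qed

abbreviation theta_galois :: "(complex \<Rightarrow> complex) monoid" where
  "theta_galois \<equiv> galois_group theta_field gaussian_rats"

lemma gaussian_rats_subset_theta_field: "gaussian_rats \<subseteq> theta_field"
  by (auto intro: theta_field_gaussian_rats)

lemma theta_galois_group: "group theta_galois"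
  by (rule galois_group_group[OF theta_field_subfield gaussian_rats_subset_theta_field])

text \<open>Restriction makes the map extensional, as membership in \<open>Bij\<close>
  demands.\<close>

definition conj_auto :: "nat \<Rightarrow> complex \<Rightarrow> complex" where
  "conj_auto k = restrict (conj_map ^^ k) theta_field"

lemma funpow_conj_map_mult: "x \<in> theta_field \<Longrightarrow> y \<in> theta_field \<Longrightarrow>
    (conj_map ^^ k) (x * y) = (conj_map ^^ k) x * (conj_map ^^ k) y"
  by (induction k) (simp_all add: conj_map_mult funpow_conj_map_closed)

lemma funpow_conj_map_add: "x \<in> theta_field \<Longrightarrow> y \<in> theta_field \<Longrightarrow>
    (conj_map ^^ k) (x + y) = (conj_map ^^ k) x + (conj_map ^^ k) y"
  by (induction k) (simp_all add: conj_map_add funpow_conj_map_closed)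

lemma funpow_conj_map_gaussian_rats: "x \<in> gaussian_rats \<Longrightarrow> (conj_map ^^ k) x = x"
  by (induction k) (simp_all add: conj_map_gaussian_rats)

lemma conj_map_bij: "bij_betw conj_map theta_field theta_field"
  by (rule bij_betw_byWitness[where f' = "\<lambda>x. conj_map (conj_map (conj_map x))"])
    (auto simp: conj_map_order_4 conj_map_closed)

lemma conj_auto_galois: "conj_auto k \<in> carrier theta_galois"
proof -
  have "bij_betw (conj_map ^^ k) theta_field theta_field"
    by (rule bij_betw_funpow[OF conj_map_bij])
  then have "conj_auto k \<in> Bij theta_field" by (auto simp: Bij_def conj_auto_def)
  then show ?thesis
    unfolding galois_group_iff
    by (auto simp: conj_auto_def funpow_conj_map_mult funpow_conj_map_add theta_field_mult
        theta_field_add theta_field_gaussian_rats gaussian_rats_1 funpow_conj_map_gaussian_rats)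
qed

lemma galois_cubic:
  assumes "\<tau> \<in> carrier theta_galois"
    and "a \<in> gaussian_rats" "b \<in> gaussian_rats" "c \<in> gaussian_rats" "d \<in> gaussian_rats"
  shows "\<tau> (cubic theta a b c d) = cubic (\<tau> theta) a b c d"
  using assms
  by (simp add: galois_group_iff cubic_def eval_nat_numeral theta_field_mult theta_field_add
      theta_field_gaussian_rats theta_field_theta)

lemma galois_eqI:
  assumes "\<sigma> \<in> carrier theta_galois" "\<tau> \<in> carrier theta_galois" "\<sigma> theta = \<tau> theta"
  shows "\<sigma> = \<tau>"
proof (rule extensionalityI)
  show "\<sigma> \<in> extensional theta_field" "\<tau> \<in> extensional theta_field"
    using assms by (auto simp: galois_group_iff Bij_def)
  fix x assume "x \<in> theta_field"
  then show "\<sigma> x = \<tau> x"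
    by (elim theta_field_E) (simp add: galois_cubic assms)
qed

lemma conj_map2_theta: "conj_map (theta\<^sup>2 - 2) = theta ^ 3 - 4 * theta + 1"
proof -
  have e: "theta\<^sup>2 - 2 = cubic theta (- 2) 0 1 0" by (simp add: cubic_def)
  show ?thesis
    unfolding e by (simp add: conj_map_coords gaussian_rats_intros) (simp add: cubic_def)
qed

lemma conj_map3_theta: "conj_map (theta ^ 3 - 4 * theta + 1) = 2 + 3 * theta - theta\<^sup>2 - theta ^ 3"
proof -
  have e: "theta ^ 3 - 4 * theta + 1 = cubic theta 1 (- 4) 0 1" by (simp add: cubic_def)
  show ?thesis
    unfolding e by (simp add: conj_map_coords gaussian_rats_intros) (simp add: cubic_def)
qed

text \<open>The quartic splits in the field itself, with the four iterates of
  \<open>conj_map\<close> at \<open>theta\<close> as its roots.\<close>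

lemma minpoly_roots:
  assumes "t ^ 4 = t ^ 3 + 4 * t\<^sup>2 - 4 * t - 1"
  obtains k where "k < 4" "t = (conj_map ^^ k) theta"
proof -
  have "(t - theta) * (t - (theta\<^sup>2 - 2)) * (t - (theta ^ 3 - 4 * theta + 1))
      * (t - (2 + 3 * theta - theta\<^sup>2 - theta ^ 3)) = t ^ 4 - t ^ 3 - 4 * t\<^sup>2 + 4 * t + 1"
    by (simp add: theta_simps)
  also have "\<dots> = 0" using assms by simp
  finally consider "t = theta" | "t = theta\<^sup>2 - 2" | "t = theta ^ 3 - 4 * theta + 1"
    | "t = 2 + 3 * theta - theta\<^sup>2 - theta ^ 3"
    by auto
  then show ?thesis
  proof cases
    case 1 then show ?thesis using that[of 0] by simp
  next
    case 2 then show ?thesis using that[of 1] by (simp add: conj_map_theta)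
  next
    case 3
    have "(conj_map ^^ 2) theta = conj_map (conj_map theta)" by (simp only: numeral_2_eq_2) simp
    then show ?thesis using that[of 2] 3 by (simp add: conj_map_theta conj_map2_theta)
  next
    case 4
    have "(conj_map ^^ 3) theta = conj_map (conj_map (conj_map theta))"
      by (simp only: numeral_3_eq_3) simp
    then show ?thesis
      using that[of 3] 4 by (simp add: conj_map_theta conj_map2_theta conj_map3_theta)
  qed
qed

lemma galois_conj_auto:
  assumes "\<tau> \<in> carrier theta_galois"
  obtains k where "k < 4" "\<tau> = conj_auto k"
proof -
  \<comment> \<open>The quartic relation in the form \<theta>^4 = \<theta> * \<theta>^3, with both
    \<theta>^4 and \<theta>^3 in coordinates: multiplicativity and \<open>galois_cubic\<close> then
    carry it over to \<open>\<tau> theta\<close>.\<close>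
  have "cubic theta (- 1) (- 4) 4 1 = theta * theta ^ 3"
    using theta_pow4 by (simp add: cubic_def eval_nat_numeral)
  then have "\<tau> (cubic theta (- 1) (- 4) 4 1) = \<tau> theta * \<tau> (cubic theta 0 0 0 1)"
    using assms
    by (simp add: galois_group_iff theta_field_theta theta_field_power cubic_def)
  then have *: "cubic (\<tau> theta) (- 1) (- 4) 4 1 = \<tau> theta * cubic (\<tau> theta) 0 0 0 1"
    by (simp add: galois_cubic assms gaussian_rats_intros)
  have "\<tau> theta ^ 4 = \<tau> theta * cubic (\<tau> theta) 0 0 0 1"
    by (simp add: cubic_def eval_nat_numeral)
  also have "\<dots> = cubic (\<tau> theta) (- 1) (- 4) 4 1" by (rule *[symmetric])
  also have "\<dots> = \<tau> theta ^ 3 + 4 * (\<tau> theta)\<^sup>2 - 4 * \<tau> theta - 1" by (simp add: cubic_def)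
  finally obtain k where "k < 4" "\<tau> theta = (conj_map ^^ k) theta" by (rule minpoly_roots)
  then show ?thesis
    using that galois_eqI[OF assms conj_auto_galois[of k]]
    by (simp add: conj_auto_def theta_field_theta)
qed

lemma conj_auto_Suc: "conj_auto 1 \<otimes>\<^bsub>theta_galois\<^esub> conj_auto k = conj_auto (Suc k)"
proof -
  have "conj_auto 1 \<otimes>\<^bsub>theta_galois\<^esub> conj_auto k = compose theta_field (conj_auto 1) (conj_auto k)"
    by (rule galois_group_mult[OF conj_auto_galois conj_auto_galois])
  also have "\<dots> = conj_auto (Suc k)"
    by (auto simp: compose_def conj_auto_def funpow_conj_map_closed)
  finally show ?thesis .
qed

lemma conj_auto_generate: "conj_auto k \<in> generate theta_galois {conj_auto 1}"
proof (induction k)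
  case 0
  have "conj_auto 0 = \<one>\<^bsub>theta_galois\<^esub>" by (auto simp: galois_group_one conj_auto_def)
  then show ?case by (simp add: generate.one)
next
  case (Suc k)
  have "conj_auto 1 \<in> generate theta_galois {conj_auto 1}" by (rule generate.incl) simp
  from generate.eng[OF this Suc] show ?case unfolding conj_auto_Suc .
qed

lemma conj_auto_generator: "is_generator theta_galois (conj_auto 1)"
proof -
  interpret group theta_galois by (rule theta_galois_group)
  have "generate theta_galois {conj_auto 1} \<subseteq> carrier theta_galois"
    by (rule generate_incl) (simp add: conj_auto_galois)
  moreover have "carrier theta_galois \<subseteq> generate theta_galois {conj_auto 1}"
  proof
    fix \<tau> assume "\<tau> \<in> carrier theta_galois"
    then obtain k where "\<tau> = conj_auto k" by (rule galois_conj_auto)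
    then show "\<tau> \<in> generate theta_galois {conj_auto 1}" using conj_auto_generate by simp
  qed
  ultimately have "generate theta_galois {conj_auto 1} = carrier theta_galois"
    by (rule subset_antisym)
  then show ?thesis unfolding is_generator_def using conj_auto_galois by blast
qed

lemma theta_field_galois_extension: "galois_extension 4 theta_field gaussian_rats"
proof -
  have "x \<in> gaussian_rats" if "x \<in> theta_field" "\<forall>\<tau>\<in>carrier theta_galois. \<tau> x = x" for x
  proof (rule conj_map_fixed)
    show "conj_map x = x"
      using that(2)[rule_format, OF conj_auto_galois[of 1]] that(1) by (simp add: conj_auto_def)
  qed fact
  then show ?thesis
    unfolding galois_extension_def
    by (auto simp: theta_field_subfield gaussian_rats_subfield dimension_theta_field
        theta_field_gaussian_rats galois_group_iff)
qed

lemma theta_field_cyclic_extension: "cyclic_extension 4 theta_field gaussian_rats"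
proof -
  interpret group theta_galois by (rule theta_galois_group)
  have "subgroup_generated theta_galois {conj_auto 1} = theta_galois"
    using conj_auto_generator conj_auto_galois[of 1]
    by (simp add: subgroup_generated_def is_generator_def)
  then have "cyclic_group theta_galois"
    using conj_auto_galois[of 1] by (auto simp: cyclic_group_def)
  then show ?thesis by (simp add: cyclic_extension_def theta_field_galois_extension)
qed

lemma conj_auto_unique:
  assumes "\<sigma> \<in> carrier theta_galois" "\<sigma> theta = theta\<^sup>2 - 2"
  shows "\<sigma> = conj_auto 1"
  by (rule galois_eqI[OF assms(1) conj_auto_galois])
    (simp add: assms(2) conj_auto_def theta_field_theta conj_map_theta)

lemma funpow_conj_auto: "x \<in> theta_field \<Longrightarrow> (conj_auto 1 ^^ r) x = (conj_map ^^ r) x"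
  by (induction r) (simp_all add: conj_auto_def funpow_conj_map_closed)


subsection \<open>Integers of the extension\<close>

definition theta_ints :: "complex set" where
  "theta_ints = {x \<in> theta_field. algebraic_int x}"

lemma carrier_ring_of_integers: "carrier (ring_of_integers L) = {x \<in> L. algebraic_int x}"
  by (simp add: ring_of_integers_def)

lemma ring_of_integers_cring:
  assumes "subfield L complex_field" shows "cring (ring_of_integers L)"
proof -
  note L = complex_subfieldD[OF assms]
  interpret field complex_field by (rule complex_field_field)
  have "subring {x \<in> L. algebraic_int x} complex_field"
    by (rule subringI)
      (auto simp: complex_field_minus L algebraic_int_1 algebraic_int_times algebraic_int_plus)
  then have "subcring {x \<in> L. algebraic_int x} complex_field" by (rule subcringI')
  then show ?thesis unfolding ring_of_integers_def using subcring_iff[of "{x \<in> L. algebraic_int x}"] by simp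
qed

lemma theta_ints_mult: "x \<in> theta_ints \<Longrightarrow> y \<in> theta_ints \<Longrightarrow> x * y \<in> theta_ints"
  by (auto simp: theta_ints_def theta_field_mult algebraic_int_times)

lemma theta_ints_add: "x \<in> theta_ints \<Longrightarrow> y \<in> theta_ints \<Longrightarrow> x + y \<in> theta_ints"
  by (auto simp: theta_ints_def theta_field_add algebraic_int_plus)

lemma theta_ints_diff: "x \<in> theta_ints \<Longrightarrow> y \<in> theta_ints \<Longrightarrow> x - y \<in> theta_ints"
  by (auto simp: theta_ints_def theta_field_diff algebraic_int_diff)

lemma theta_ints_gaussian: "x \<in> gaussian_ints \<Longrightarrow> x \<in> theta_ints"
  by (auto simp: theta_ints_def gaussian_ints_iff theta_field_gaussian_rats)

lemma theta_ints_theta: "theta \<in> theta_ints"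
  by (auto simp: theta_ints_def theta_field_theta theta_algebraic_int)

lemma theta_ints_power: "x \<in> theta_ints \<Longrightarrow> x ^ n \<in> theta_ints"
  by (auto simp: theta_ints_def theta_field_power algebraic_int_power)

lemma gaussian_ints_add: "x \<in> gaussian_ints \<Longrightarrow> y \<in> gaussian_ints \<Longrightarrow> x + y \<in> gaussian_ints"
  and gaussian_ints_mult: "x \<in> gaussian_ints \<Longrightarrow> y \<in> gaussian_ints \<Longrightarrow> x * y \<in> gaussian_ints"
  and gaussian_ints_diff: "x \<in> gaussian_ints \<Longrightarrow> y \<in> gaussian_ints \<Longrightarrow> x - y \<in> gaussian_ints"
  and gaussian_ints_uminus: "x \<in> gaussian_ints \<Longrightarrow> - x \<in> gaussian_ints"
  by (auto simp: gaussian_ints_iff gaussian_rats_intros algebraic_int_plus algebraic_int_times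
      algebraic_int_diff)

lemma gaussian_ints_i: "\<i> \<in> gaussian_ints" and gaussian_ints_0: "0 \<in> gaussian_ints"
  and gaussian_ints_1: "1 \<in> gaussian_ints" and gaussian_ints_numeral: "numeral n \<in> gaussian_ints"
  by (auto simp: gaussian_ints_iff gaussian_rats_intros algebraic_int_1 algebraic_int_numeral)

lemma gaussian_ints_of_int: "of_int k \<in> gaussian_ints"
  using gaussian_ints_I[of k 0] by simp

lemmas gaussian_ints_intros =
  gaussian_ints_add gaussian_ints_mult gaussian_ints_diff gaussian_ints_uminus
  gaussian_ints_i gaussian_ints_0 gaussian_ints_1 gaussian_ints_numeral gaussian_ints_of_int

lemma conj_map_poly:
  assumes "x \<in> theta_field"
  shows "poly (map_poly of_int p) x \<in> theta_field \<and>
    conj_map (poly (map_poly of_int p) x) = poly (map_poly of_int p) (conj_map x)"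
proof (induction p)
  case 0
  then show ?case
    by (simp add: theta_field_gaussian_rats gaussian_rats_0 conj_map_gaussian_rats)
next
  case (pCons a p)
  have "of_int a \<in> gaussian_rats" using gaussian_rats_rat[of "of_int a"] by simp
  then show ?case
    using pCons assms
    by (simp add: map_poly_pCons conj_map_add conj_map_mult theta_field_add theta_field_mult
        theta_field_gaussian_rats conj_map_gaussian_rats)
qed

text \<open>\<open>conj_map\<close> commutes with integer polynomials, so a conjugate satisfies the
  same monic equation.\<close>

lemma conj_map_theta_ints:
  assumes "x \<in> theta_ints" shows "conj_map x \<in> theta_ints"
proof -
  have x: "x \<in> theta_field" "algebraic_int x" using assms by (auto simp: theta_ints_def)
  obtain p :: "int poly" where p: "poly (map_poly of_int p) x = 0" "Polynomial.lead_coeff p = 1"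
    using x(2) by (auto simp: algebraic_int_altdef_ipoly)
  have "poly (map_poly of_int p) (conj_map x) = 0"
    using conj_map_poly[OF x(1), of p] p(1) conj_map_gaussian_rats[OF gaussian_rats_0] by simp
  then have "algebraic_int (conj_map x)" using p(2) by (auto simp: algebraic_int_altdef_ipoly)
  then show ?thesis using x(1) by (simp add: theta_ints_def conj_map_closed)
qed

lemma funpow_conj_map_theta_ints: "x \<in> theta_ints \<Longrightarrow> (conj_map ^^ k) x \<in> theta_ints"
  by (induction k) (auto intro: conj_map_theta_ints)

lemma rel_norm_gaussian_ints: "x \<in> theta_ints \<Longrightarrow> rel_norm x \<in> gaussian_ints"
  unfolding gaussian_ints_iff
  using rel_norm_gaussian_rats[of x] theta_ints_mult conj_map_theta_ints
  by (auto simp: theta_ints_def rel_norm_def)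

lemma rel_trace_gaussian_ints: "x \<in> theta_ints \<Longrightarrow> rel_trace x \<in> gaussian_ints"
  unfolding gaussian_ints_iff
  using rel_trace_gaussian_rats[of x] theta_ints_add conj_map_theta_ints
  by (auto simp: theta_ints_def rel_trace_def)

section \<open>Divisibility of relative traces by a prime\<close>

lemma frobenius_add:
  assumes "Factorial_Ring.prime p" "algebraic_int (x :: complex)" "algebraic_int y"
  obtains q where "algebraic_int q" "(x + y) ^ p = x ^ p + y ^ p + of_nat p * q"
proof
  define q where "q = (\<Sum>k\<in>{1..<p}. of_int (int ((p choose k) div p)) * (x ^ k * y ^ (p - k)))"
  have sum_int: "algebraic_int (sum f S)" if "\<And>k. k \<in> S \<Longrightarrow> algebraic_int (f k :: complex)" for f :: "nat \<Rightarrow> complex" and S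
    using that by (induction S rule: infinite_finite_induct) (auto intro: algebraic_int_plus)
  show "algebraic_int q"
    unfolding q_def
    by (intro sum_int algebraic_int_times algebraic_int_power algebraic_int_of_int assms)
  have p0: "p > 0" using prime_gt_0_nat[OF assms(1)] .
  have "{..p} = insert 0 (insert p {1..<p})" using p0 by auto
  then have "(x + y) ^ p = x ^ p + y ^ p + (\<Sum>k\<in>{1..<p}. of_nat (p choose k) * x ^ k * y ^ (p - k))"
    unfolding binomial_ring using p0 by simp
  also have "(\<Sum>k\<in>{1..<p}. of_nat (p choose k) * x ^ k * y ^ (p - k)) = of_nat p * q"
    unfolding q_def sum_distrib_left
  proof (rule sum.cong)
    fix k assume k: "k \<in> {1..<p}"
    then have "p dvd (p choose k)" by (intro dvd_choose_prime assms(1)) auto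
    then have "of_nat (p choose k) = of_nat p * (of_nat ((p choose k) div p) :: complex)"
      by (metis dvd_mult_div_cancel of_nat_mult)
    then show "of_nat (p choose k) * x ^ k * y ^ (p - k)
        = of_nat p * (of_int (int ((p choose k) div p)) * (x ^ k * y ^ (p - k)))"
      by (simp add: mult.assoc)
  qed simp
  finally show "(x + y) ^ p = x ^ p + y ^ p + of_nat p * q" .
qed

text \<open>\<open>Tr(x\<beta>)\<^sup>p \<equiv> Tr(x\<^sup>p \<beta>\<^sup>p) \<equiv> 0 (mod p)\<close> by the Frobenius congruence. This replaces a
  computation of the ring of integers of \<open>\<rat>(\<i>, \<theta>)\<close>.\<close>

lemma prime_dvd_rel_trace:
  assumes p: "Factorial_Ring.prime p" "odd p" and x: "x \<in> theta_ints" and b: "\<beta> \<in> theta_ints"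
    and dvd: "\<beta> ^ p = of_nat p * q" "q \<in> theta_ints"
  obtains u v where "rel_trace (x * \<beta>) = of_int u + of_int v * \<i>" "int p dvd u" "int p dvd v"
proof -
  define y where "y = (\<lambda>k. (conj_map ^^ k) (x * \<beta>))"
  have xb: "x * \<beta> \<in> theta_ints" using x b by (rule theta_ints_mult)
  have y: "algebraic_int (y k)" for k
    using funpow_conj_map_theta_ints[OF xb, of k] by (simp add: y_def theta_ints_def)
  have tr: "rel_trace (x * \<beta>) = (y 0 + y 1) + (y 2 + y 3)"
    by (simp add: rel_trace_def y_def eval_nat_numeral)
  \<comment> \<open>Each conjugate of \<open>(x * \<beta>) ^ p\<close> inherits the factor
    \<open>p\<close> from \<open>\<beta> ^ p\<close>.\<close>
  have "\<exists>z. algebraic_int z \<and> y k ^ p = of_nat p * z" for k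
  proof -
    have F: "x \<in> theta_field" "\<beta> \<in> theta_field" "q \<in> theta_field"
      using x b dvd(2) by (auto simp: theta_ints_def)
    have pq: "of_nat p \<in> gaussian_rats" using gaussian_rats_rat[of "of_nat p"] by simp
    have "y k ^ p = (conj_map ^^ k) ((x * \<beta>) ^ p)"
      unfolding y_def
      by (induction p) (simp_all add: funpow_conj_map_mult theta_field_mult theta_field_power F
          funpow_conj_map_gaussian_rats gaussian_rats_1)
    also have "(x * \<beta>) ^ p = of_nat p * (x ^ p * q)"
      by (simp add: power_mult_distrib dvd(1) mult_ac)
    also have "(conj_map ^^ k) (of_nat p * (x ^ p * q)) = of_nat p * (conj_map ^^ k) (x ^ p * q)"
      using pq by (simp add: funpow_conj_map_mult theta_field_mult theta_field_power F
          funpow_conj_map_gaussian_rats theta_field_gaussian_rats)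
    finally have "y k ^ p = of_nat p * (conj_map ^^ k) (x ^ p * q)" .
    moreover have "algebraic_int ((conj_map ^^ k) (x ^ p * q))"
      using funpow_conj_map_theta_ints[OF theta_ints_mult[OF theta_ints_power[OF x] dvd(2)], of k p]
      by (simp add: theta_ints_def)
    ultimately show ?thesis by blast
  qed
  then obtain z where z: "\<And>k. algebraic_int (z k)" "\<And>k. y k ^ p = of_nat p * z k" by metis
  obtain q1 where q1: "algebraic_int q1" "(y 0 + y 1) ^ p = y 0 ^ p + y 1 ^ p + of_nat p * q1"
    using frobenius_add[OF p(1) y y] .
  obtain q2 where q2: "algebraic_int q2" "(y 2 + y 3) ^ p = y 2 ^ p + y 3 ^ p + of_nat p * q2"
    using frobenius_add[OF p(1) y y] .
  obtain q3 where q3: "algebraic_int q3"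
    "(y 0 + y 1 + (y 2 + y 3)) ^ p = (y 0 + y 1) ^ p + (y 2 + y 3) ^ p + of_nat p * q3"
    using frobenius_add[OF p(1) algebraic_int_plus[OF y y] algebraic_int_plus[OF y y]] .
  have "rel_trace (x * \<beta>) \<in> gaussian_ints" by (rule rel_trace_gaussian_ints[OF xb])
  then obtain u v where uv: "rel_trace (x * \<beta>) = of_int u + of_int v * \<i>"
    by (auto simp: gaussian_ints_def)
  obtain q4 where q4: "algebraic_int q4"
    "(of_int u + of_int v * \<i>) ^ p = of_int u ^ p + (of_int v * \<i>) ^ p + of_nat p * q4"
    using frobenius_add[OF p(1) algebraic_int_of_int algebraic_int_times[OF algebraic_int_of_int algebraic_int_ii]] .
  obtain h where h: "p = 2 * h + 1" using p(2) by (rule oddE)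
  \<comment> \<open>Frobenius is now applied to the trace as a Gaussian integer. Because
    \<open>p\<close> is odd, the power of the imaginary part stays imaginary, so divisibility can be
    read off in each part, whether \<open>p\<close> is inert or split in Z[i].\<close>
  have ip: "(of_int v * \<i>) ^ p = of_int ((- 1) ^ h * v ^ p) * \<i>"
  proof -
    have "\<i> ^ p = (- 1) ^ h * \<i>" by (simp add: h power_mult)
    then show ?thesis by (simp add: power_mult_distrib)
  qed
  define w where "w = z 0 + z 1 + z 2 + z 3 + q1 + q2 + q3 - q4"
  have "of_int (u ^ p) + of_int ((- 1) ^ h * v ^ p) * \<i> = of_nat p * w"
    using q1(2) q2(2) q3(2) q4(2) z(2)
    unfolding ip uv[symmetric] tr w_def by (simp add: algebra_simps)
  then have quot: "(of_int (u ^ p) + of_int ((- 1) ^ h * v ^ p) * \<i>) / of_int (int p) = w"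
    using prime_gt_0_nat[OF p(1)] by (simp add: field_simps)
  have "algebraic_int w"
    unfolding w_def by (intro algebraic_int_plus algebraic_int_diff z(1) q1(1) q2(1) q3(1) q4(1))
  moreover have "(of_int (u ^ p) + of_int ((- 1) ^ h * v ^ p) * \<i>) / of_int (int p) \<in> gaussian_rats"
    unfolding divide_inverse
    by (intro gaussian_rats_mult gaussian_rats_inverse gaussian_ints_rats gaussian_ints_I gaussian_ints_of_int)
  ultimately have "(of_int (u ^ p) + of_int ((- 1) ^ h * v ^ p) * \<i>) / of_int (int p) \<in> gaussian_ints"
    unfolding quot by (simp add: gaussian_ints_iff)
  moreover have "int p \<noteq> 0" using prime_gt_0_nat[OF p(1)] by simp
  ultimately have "int p dvd u ^ p" "int p dvd (- 1) ^ h * v ^ p"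
    by (rule of_int_gaussian_rat_dvd)+
  then have pow: "int p dvd u ^ p" "int p dvd v ^ p"
    by (simp_all add: minus_one_power_iff split: if_splits)
  have "Factorial_Ring.prime (int p)" using p(1) by simp
  then have "int p dvd u" "int p dvd v"
    using prime_dvd_power[OF _ pow(1)] prime_dvd_power[OF _ pow(2)] by blast+
  then show ?thesis using that uv by blast
qed


subsection \<open>The ideal and its basis\<close>

definition alpha :: complex where
  "alpha = 1 - 3 * \<i> + \<i> * theta\<^sup>2"

definition alpha_norm :: complex where
  "alpha_norm = 9 - 4 * theta - 2 * theta\<^sup>2 + theta ^ 3"

text \<open>In terms of \<open>\<zeta>\<close>, a primitive 15th root of unity with
  \<open>theta = \<zeta> + inverse \<zeta>\<close>, and s_k = \<zeta>^k + \<zeta>^(-k), the entries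
  are 1, s_1, s_3 and s_3 + s_2 + 1. They arise from the powers of \<open>theta\<close> by a
  unimodular change of basis that makes Tr(omega_j omega_k \<beta>) equal to 15 for j = k and 0
  otherwise.\<close>

definition omega :: "nat \<Rightarrow> complex" where
  "omega k = [1, theta, theta ^ 3 - 3 * theta, theta ^ 3 + theta\<^sup>2 - 3 * theta - 1] ! k"

definition nu :: "nat \<Rightarrow> complex" where
  "nu k = alpha * omega k"

lemma alpha_norm: "alpha * cnj alpha = alpha_norm"
  by (simp add: alpha_def alpha_norm_def theta_simps)

lemma alpha_norm_cube: "alpha_norm ^ 3 = of_nat 3 * (269 - 203 * theta - 68 * theta\<^sup>2 + 54 * theta ^ 3)"
  by (simp add: alpha_norm_def theta_simps)

lemma alpha_norm_pow5:
  "alpha_norm ^ 5 = of_nat 5 * (15237 - 11907 * theta - 3852 * theta\<^sup>2 + 3177 * theta ^ 3)"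
proof -
  have 2: "alpha_norm\<^sup>2 = 84 - 57 * theta - 21 * theta\<^sup>2 + 15 * theta ^ 3"
    by (simp add: alpha_norm_def theta_simps)
  have "alpha_norm ^ 5 = alpha_norm\<^sup>2 * alpha_norm ^ 3" by (simp flip: power_add)
  then show ?thesis unfolding 2 alpha_norm_cube by (simp add: theta_simps)
qed

lemmas theta_ints_intros =
  theta_ints_add theta_ints_diff theta_ints_mult theta_ints_power theta_ints_theta
  theta_ints_gaussian gaussian_ints_i gaussian_ints_1 gaussian_ints_numeral

lemma rel_trace_alpha_norm:
  assumes "x \<in> theta_ints"
  obtains c where "c \<in> gaussian_ints" "rel_trace (x * alpha_norm) = 15 * c"
proof -
  have an: "alpha_norm \<in> theta_ints"
    unfolding alpha_norm_def by (intro theta_ints_intros)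
  obtain u v where uv: "rel_trace (x * alpha_norm) = of_int u + of_int v * \<i>" "3 dvd u" "3 dvd v"
    by (rule prime_dvd_rel_trace[OF _ _ assms an alpha_norm_cube]) (simp_all add: theta_ints_intros)
  obtain u' v' where uv': "rel_trace (x * alpha_norm) = of_int u' + of_int v' * \<i>"
      "5 dvd u'" "5 dvd v'"
    by (rule prime_dvd_rel_trace[OF _ _ assms an alpha_norm_pow5]) (simp_all add: theta_ints_intros)
  have "u' = u" "v' = v" using uv(1) uv'(1) by (simp_all add: complex_eq_iff)
  then have "15 dvd u" "15 dvd v"
    using uv(2,3) uv'(2,3) by presburger+
  then obtain a b where "u = 15 * a" "v = 15 * b" by (auto elim!: dvdE)
  then have "rel_trace (x * alpha_norm) = 15 * (of_int a + of_int b * \<i>)"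
    unfolding uv(1) by (simp add: algebra_simps)
  then show ?thesis using that gaussian_ints_I by blast
qed


lemma nu_simps:
  "nu 0 = (1 - 3 * \<i>) + \<i> * theta\<^sup>2"
  "nu (Suc 0) = (1 - 3 * \<i>) * theta + \<i> * theta ^ 3"
  "nu 2 = - \<i> + (-3 + 4 * \<i>) * theta + (1 - \<i>) * theta ^ 3"
  "nu 3 = (-1 + \<i>) - 3 * theta + theta\<^sup>2 + theta ^ 3"
  by (simp_all add: nu_def omega_def alpha_def theta_simps)

lemma nu_cubic:
  "nu 0 = cubic theta (1 - 3 * \<i>) 0 \<i> 0"
  "nu (Suc 0) = cubic theta 0 (1 - 3 * \<i>) 0 \<i>"
  "nu 2 = cubic theta (- \<i>) (4 * \<i> - 3) 0 (1 - \<i>)"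
  "nu 3 = cubic theta (\<i> - 1) (- 3) 1 1"
  by (simp_all add: nu_simps cubic_def algebra_simps)

lemma lessThan_4: "{..<4::nat} = {0, Suc 0, 2, 3}"
  by auto

lemma nu_field: "k < 4 \<Longrightarrow> nu k \<in> theta_field"
  using nu_cubic by (auto simp: numeral_eq_Suc less_Suc_eq intro!: theta_field_I gaussian_rats_intros)


lemma conj_map_nu:
  "conj_map (nu 0) = cubic theta 1 (- 4 * \<i>) 0 \<i>"
  "conj_map (nu (Suc 0)) = cubic theta (- 2 - \<i>) (3 * \<i>) 1 (- \<i>)"
  "conj_map (nu 2) = cubic theta (- 1 - 2 * \<i>) (3 - 3 * \<i>) \<i> (\<i> - 1)"
  "conj_map (nu 3) = cubic theta (1 + \<i>) (- 1) 0 0"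
  by (simp_all add: nu_cubic conj_map_coords gaussian_rats_intros)
    (simp_all add: cubic_def algebra_simps)?

lemma conj_map2_nu:
  "conj_map (conj_map (nu 0)) = cubic theta (1 + \<i>) (3 * \<i>) (- \<i>) (- \<i>)"
  "conj_map (conj_map (nu (Suc 0))) = cubic theta 1 (- 4 - 3 * \<i>) 0 (1 + \<i>)"
  "conj_map (conj_map (nu 2)) = cubic theta 0 (- 3 - \<i>) 0 1"
  "conj_map (conj_map (nu 3)) = cubic theta (3 + \<i>) 0 (- 1) 0"
  by (simp_all add: conj_map_nu conj_map_coords gaussian_rats_intros)
    (simp_all add: cubic_def algebra_simps)?

lemma conj_map3_nu:
  "conj_map (conj_map (conj_map (nu 0))) = cubic theta (1 - \<i>) \<i> 0 0"
  "conj_map (conj_map (conj_map (nu (Suc 0)))) = cubic theta (2 - \<i>) (3 + 3 * \<i>) (- 1) (- 1 - \<i>)"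
  "conj_map (conj_map (conj_map (nu 2))) = cubic theta (2 * \<i> - 1) 3 (- \<i>) (- 1)"
  "conj_map (conj_map (conj_map (nu 3))) = cubic theta \<i> 4 0 (- 1)"
  by (simp_all add: conj_map2_nu conj_map_coords gaussian_rats_intros)
    (simp_all add: cubic_def algebra_simps)?

lemma cnj_cubic: "cnj (cubic theta a b c d) = cubic theta (cnj a) (cnj b) (cnj c) (cnj d)"
  by (simp add: cubic_def)

lemma cubic_theta_mult_reduced:
  "cubic theta a b c d * cubic theta a' b' c' d' =
    cubic theta
      (a * a' - (b * d' + c * c' + d * b') - (c * d' + d * c') - 5 * (d * d'))
      (a * b' + b * a' - 4 * (b * d' + c * c' + d * b') - 5 * (c * d' + d * c') - 21 * (d * d'))
      (a * c' + b * b' + c * a' + 4 * (b * d' + c * c' + d * b') + 15 * (d * d'))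
      (a * d' + b * c' + c * b' + d * a' + (b * d' + c * c' + d * b') + 5 * (c * d' + d * c')
        + 5 * (d * d'))"
  by (rule cubic_mult[OF theta_pow4])

lemma less_4_cases: "(k :: nat) < 4 \<Longrightarrow> k = 0 \<or> k = Suc 0 \<or> k = 2 \<or> k = 3"
  by auto

lemma funpow_2_3: "(f ^^ 2) x = f (f x)" "(f ^^ 3) x = f (f (f x))"
  by (simp_all add: eval_nat_numeral)

text \<open>Orthogonality of the rows of the unscaled layer matrix. For each pair of rows the sum is
  expanded in coordinates over the powers of \<open>theta\<close>, using the tables of conjugates
  above; all coordinates cancel except possibly the constant one.\<close>

lemma nu_orthogonal:
  assumes "r < 4" "s < 4"
  shows "(\<Sum>k<4. (conj_map ^^ r) (nu k) * cnj ((conj_map ^^ s) (nu k))) = (if r = s then 15 else 0)"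
proof -
  let ?S = "\<lambda>r s. \<Sum>k<4. (conj_map ^^ r) (nu k) * cnj ((conj_map ^^ s) (nu k))"
  note s_cases = less_4_cases[OF assms(2)]
  have 0: "?S 0 s = (if 0 = s then 15 else 0)"
    using s_cases
    by (elim disjE; simp add: lessThan_4 funpow_2_3; (simp only: conj_map3_nu)?;
        (simp only: conj_map2_nu)?; (simp only: conj_map_nu)?; (simp only: nu_cubic)?;
        simp add: cubic_theta_mult_reduced cubic_add cnj_cubic; (simp add: cubic_def algebra_simps)?)
  have 1: "?S (Suc 0) s = (if (Suc 0) = s then 15 else 0)"
    using s_cases
    by (elim disjE; simp add: lessThan_4 funpow_2_3; (simp only: conj_map3_nu)?;
        (simp only: conj_map2_nu)?; (simp only: conj_map_nu)?; (simp only: nu_cubic)?;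
        simp add: cubic_theta_mult_reduced cubic_add cnj_cubic; (simp add: cubic_def algebra_simps)?)
  have 2: "?S 2 s = (if 2 = s then 15 else 0)"
    using s_cases
    by (elim disjE; simp add: lessThan_4 funpow_2_3; (simp only: conj_map3_nu)?;
        (simp only: conj_map2_nu)?; (simp only: conj_map_nu)?; (simp only: nu_cubic)?;
        simp add: cubic_theta_mult_reduced cubic_add cnj_cubic; (simp add: cubic_def algebra_simps)?)
  have 3: "?S 3 s = (if 3 = s then 15 else 0)"
    using s_cases
    by (elim disjE; simp add: lessThan_4 funpow_2_3; (simp only: conj_map3_nu)?;
        (simp only: conj_map2_nu)?; (simp only: conj_map_nu)?; (simp only: nu_cubic)?;
        simp add: cubic_theta_mult_reduced cubic_add cnj_cubic; (simp add: cubic_def algebra_simps)?)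
  show ?thesis using less_4_cases[OF assms(1)] 0 1 2 3 by (elim disjE) simp_all
qed

lemma cnj_gaussian_rats: "x \<in> gaussian_rats \<Longrightarrow> cnj x \<in> gaussian_rats"
proof -
  assume "x \<in> gaussian_rats"
  then obtain p q where "x = of_rat p + of_rat q * \<i>" by (rule gaussian_rats_E)
  then have "cnj x = of_rat p + of_rat (- q) * \<i>" by (simp add: of_rat_minus)
  then show ?thesis by (metis gaussian_rats_I)
qed

lemma cnj_theta_field: "x \<in> theta_field \<Longrightarrow> cnj x \<in> theta_field"
  by (elim theta_field_E) (simp add: cnj_cubic theta_field_I cnj_gaussian_rats)

text \<open>Complex conjugation acts on the Gaussian coordinates alone, while
  \<open>conj_map\<close> mixes them with integer coefficients.\<close>

lemma conj_map_cnj: "x \<in> theta_field \<Longrightarrow> conj_map (cnj x) = cnj (conj_map x)"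
  by (elim theta_field_E) (simp add: cnj_cubic conj_map_coords cnj_gaussian_rats gaussian_rats_intros)

lemma rel_trace_sum:
  "x \<in> theta_field \<Longrightarrow> rel_trace x = (\<Sum>r<4. (conj_map ^^ r) x)"
  by (simp add: rel_trace_def lessThan_4 funpow_2_3 add_ac)

lemma funpow_conj_map_cnj: "x \<in> theta_field \<Longrightarrow> (conj_map ^^ r) (cnj x) = cnj ((conj_map ^^ r) x)"
  by (induction r) (simp_all add: conj_map_cnj funpow_conj_map_closed)

text \<open>Unitarity of the layer matrix makes \<open>Tr(z \<nu>\<^sub>k\<^sup>*) / 15\<close> the coordinates of \<open>z\<close> in the basis
  \<open>\<nu>\<close>.\<close>

lemma nu_expansion:
  assumes z: "z \<in> theta_field"
  shows "(\<Sum>k<4. rel_trace (z * cnj (nu k)) * nu k) = 15 * z"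
proof -
  have "(\<Sum>k<4. rel_trace (z * cnj (nu k)) * nu k)
      = (\<Sum>k<4. \<Sum>r<4. (conj_map ^^ r) z * (nu k * cnj ((conj_map ^^ r) (nu k))))"
  proof (rule sum.cong)
    fix k :: nat assume "k \<in> {..<4}"
    then have k: "nu k \<in> theta_field" by (simp add: nu_field)
    then show "rel_trace (z * cnj (nu k)) * nu k
      = (\<Sum>r<4. (conj_map ^^ r) z * (nu k * cnj ((conj_map ^^ r) (nu k))))"
      by (simp add: rel_trace_sum theta_field_mult cnj_theta_field z funpow_conj_map_mult
          funpow_conj_map_cnj sum_distrib_right sum_distrib_left mult_ac)
  qed simp
  \<comment> \<open>After the swap the inner sum pairs row 0 with row \<open>r\<close>, so
    orthogonality removes every proper conjugate of \<open>z\<close>.\<close>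
  also have "\<dots> = (\<Sum>r<4. (conj_map ^^ r) z * (\<Sum>k<4. nu k * cnj ((conj_map ^^ r) (nu k))))"
    by (subst sum.swap) (simp add: sum_distrib_left)
  also have "\<dots> = (\<Sum>r<4. (conj_map ^^ r) z * (if 0 = r then 15 else 0))"
    by (rule sum.cong) (use nu_orthogonal[of 0] in auto)
  also have "\<dots> = 15 * z" by (simp add: lessThan_4)
  finally show ?thesis .
qed

lemma cnj_omega: "k < 4 \<Longrightarrow> cnj (omega k) = omega k"
  by (drule less_4_cases) (auto simp: omega_def)

lemma omega_theta_ints: "k < 4 \<Longrightarrow> omega k \<in> theta_ints"
  by (drule less_4_cases) (auto simp: omega_def theta_ints_intros)

lemma omega_independent:
  assumes "\<And>k. k < 4 \<Longrightarrow> a k \<in> gaussian_rats" "(\<Sum>k<4. a k * omega k) = 0" "k < 4"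
  shows "a k = 0"
proof -
  have a: "a 0 \<in> gaussian_rats" "a 1 \<in> gaussian_rats" "a 2 \<in> gaussian_rats" "a 3 \<in> gaussian_rats"
    using assms(1) by auto
  have "(a 0 - a 3) + (a 1 - 3 * a 2 - 3 * a 3) * theta + a 3 * theta\<^sup>2 + (a 2 + a 3) * theta ^ 3 = 0"
    using assms(2) by (simp add: lessThan_4 omega_def algebra_simps)
  then have "a 0 - a 3 = 0 \<and> a 1 - 3 * a 2 - 3 * a 3 = 0 \<and> a 3 = 0 \<and> a 2 + a 3 = 0"
    by (intro theta_independent gaussian_rats_intros a)
  then have "a 0 = 0" "a (Suc 0) = 0" "a 2 = 0" "a 3 = 0" by auto
  then show ?thesis using less_4_cases[OF assms(3)] by auto
qed

lemma alpha_nonzero: "alpha \<noteq> 0"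
proof
  assume "alpha = 0"
  then have "(1 - 3 * \<i>) + 0 * theta + \<i> * theta\<^sup>2 + 0 * theta ^ 3 = 0" by (simp add: alpha_def)
  then have "\<i> = 0" by (rule theta_independent[THEN conjunct2, THEN conjunct2, THEN conjunct1, rotated 4])
      (simp_all add: gaussian_rats_intros)
  then show False by simp
qed

lemma nu_independent:
  assumes "\<And>k. k < 4 \<Longrightarrow> a k \<in> gaussian_rats" "(\<Sum>k<4. a k * nu k) = 0" "k < 4"
  shows "a k = 0"
proof (rule omega_independent[OF assms(1) _ assms(3)])
  have "alpha * (\<Sum>k<4. a k * omega k) = (\<Sum>k<4. a k * nu k)"
    unfolding sum_distrib_left by (simp add: nu_def mult_ac)
  then show "(\<Sum>k<4. a k * omega k) = 0" using assms(2) alpha_nonzero by simp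
qed

lemma theta_ints_sum: "(\<And>k. k \<in> S \<Longrightarrow> f k \<in> theta_ints) \<Longrightarrow> sum f S \<in> theta_ints"
  by (induction S rule: infinite_finite_induct)
    (auto intro: theta_ints_add theta_ints_gaussian gaussian_ints_0)

lemma alpha_theta_ints: "alpha \<in> theta_ints"
  unfolding alpha_def by (intro theta_ints_intros)

lemma theta_ints_carrier: "carrier (ring_of_integers theta_field) = theta_ints"
  by (simp add: carrier_ring_of_integers theta_ints_def)

lemma gaussian_ints_carrier: "carrier (ring_of_integers gaussian_rats) = gaussian_ints"
  using gaussian_ints_iff by (auto simp: carrier_ring_of_integers)

lemma alpha_ideal: "cgenideal (ring_of_integers theta_field) alpha = {x * alpha | x. x \<in> theta_ints}"
  by (simp add: cgenideal_def theta_ints_carrier) (simp add: ring_of_integers_def)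

lemma nu_nth: "k < 4 \<Longrightarrow> [nu 0, nu 1, nu 2, nu 3] ! k = nu k"
  by (drule less_4_cases) auto

lemma nu_module_basis:
  "is_module_basis gaussian_ints [nu 0, nu 1, nu 2, nu 3] (cgenideal (ring_of_integers theta_field) alpha)"
proof -
  have span: "(\<Sum>k<4. a k * nu k) \<in> {x * alpha | x. x \<in> theta_ints}"
    if "\<forall>k<4. a k \<in> gaussian_ints" for a
  proof -
    have "(\<Sum>k<4. a k * nu k) = (\<Sum>k<4. a k * omega k) * alpha"
      unfolding sum_distrib_right by (simp add: nu_def mult_ac)
    moreover have "(\<Sum>k<4. a k * omega k) \<in> theta_ints"
      by (rule theta_ints_sum)
        (use that in \<open>auto simp: theta_ints_mult theta_ints_gaussian omega_theta_ints\<close>)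
    ultimately show ?thesis by blast
  qed
  have coords: "\<exists>a. (\<forall>k<4. a k \<in> gaussian_ints) \<and> x * alpha = (\<Sum>k<4. a k * nu k)"
    if x: "x \<in> theta_ints" for x
  proof -
    have "\<exists>c \<in> gaussian_ints. rel_trace (x * alpha * cnj (nu k)) = 15 * c" if k: "k < 4" for k
    proof -
      \<comment> \<open>Since \<open>omega k\<close> is real, complex conjugation affects only
        \<open>alpha\<close>, and the product acquires the factor \<open>alpha_norm\<close>.\<close>
      have "x * alpha * cnj (nu k) = (x * omega k) * alpha_norm"
        by (simp add: nu_def cnj_omega[OF k] alpha_norm[symmetric] mult_ac)
      then show ?thesis
        using rel_trace_alpha_norm[OF theta_ints_mult[OF x omega_theta_ints[OF k]]] by metis
    qed
    then obtain c where c: "\<And>k. k < 4 \<Longrightarrow> c k \<in> gaussian_ints"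
      "\<And>k. k < 4 \<Longrightarrow> rel_trace (x * alpha * cnj (nu k)) = 15 * c k"
      by metis
    have "x * alpha \<in> theta_field" using theta_ints_mult[OF x alpha_theta_ints] by (simp add: theta_ints_def)
    from nu_expansion[OF this]
    have "15 * (x * alpha) = (\<Sum>k<4. rel_trace (x * alpha * cnj (nu k)) * nu k)" by (rule sym)
    also have "\<dots> = (\<Sum>k<4. 15 * (c k * nu k))"
      by (rule sum.cong) (auto simp: c(2))
    also have "\<dots> = 15 * (\<Sum>k<4. c k * nu k)" by (rule sum_distrib_left[symmetric])
    finally have "15 * (x * alpha) = 15 * (\<Sum>k<4. c k * nu k)" .
    then have "x * alpha = (\<Sum>k<4. c k * nu k)" by simp
    then show ?thesis using c(1) by blast
  qed
  have len: "length [nu 0, nu 1, nu 2, nu 3] = 4" by simp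
  have eq: "(\<Sum>k<4. a k * [nu 0, nu 1, nu 2, nu 3] ! k) = (\<Sum>k<4. a k * nu k)" for a
    by (rule sum.cong) (simp_all only: lessThan_iff nu_nth)
  show ?thesis
    unfolding is_module_basis_def len eq alpha_ideal
  proof (intro conjI allI impI)
    show "{\<Sum>k<4. a k * nu k | a. \<forall>k<4. a k \<in> gaussian_ints} = {x * alpha | x. x \<in> theta_ints}"
    proof (intro subset_antisym subsetI)
      fix z assume "z \<in> {\<Sum>k<4. a k * nu k | a. \<forall>k<4. a k \<in> gaussian_ints}"
      then show "z \<in> {x * alpha | x. x \<in> theta_ints}" using span by blast
    next
      fix z assume "z \<in> {x * alpha | x. x \<in> theta_ints}"
      then show "z \<in> {\<Sum>k<4. a k * nu k | a. \<forall>k<4. a k \<in> gaussian_ints}" using coords by blast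
    qed
  next
    fix a k assume "(\<forall>k<4. a k \<in> gaussian_ints) \<and> (\<Sum>k<4. a k * nu k) = 0" "k < (4 :: nat)"
    then show "a k = 0" using nu_independent[of a k] gaussian_ints_rats by blast
  qed
qed


subsection \<open>Determinants of codewords\<close>

text \<open>The determinant with rows \<open>(x\<^sub>0, x\<^sub>1, x\<^sub>2, x\<^sub>3)\<close>, \<open>(g y\<^sub>3, y\<^sub>0, y\<^sub>1, y\<^sub>2)\<close>,
  \<open>(g z\<^sub>2, g z\<^sub>3, z\<^sub>0, z\<^sub>1)\<close>, \<open>(g w\<^sub>1, g w\<^sub>2, g w\<^sub>3, w\<^sub>0)\<close>, expanded along pairs of rows.\<close>

definition twisted_det ::
  "'a :: comm_ring_1 \<Rightarrow> (nat \<Rightarrow> 'a) \<Rightarrow> (nat \<Rightarrow> 'a) \<Rightarrow> (nat \<Rightarrow> 'a) \<Rightarrow> (nat \<Rightarrow> 'a) \<Rightarrow> 'a" where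
  "twisted_det g x y z w =
     (x 0 * y 0 - x 1 * (g * y 3)) * (z 0 * w 0 - z 1 * (g * w 3))
   - (x 0 * y 1 - x 2 * (g * y 3)) * ((g * z 3) * w 0 - z 1 * (g * w 2))
   + (x 0 * y 2 - x 3 * (g * y 3)) * ((g * z 3) * (g * w 3) - z 0 * (g * w 2))
   + (x 1 * y 1 - x 2 * y 0) * ((g * z 2) * w 0 - z 1 * (g * w 1))
   - (x 1 * y 2 - x 3 * y 0) * ((g * z 2) * (g * w 3) - z 0 * (g * w 1))
   + (x 2 * y 2 - x 3 * y 1) * ((g * z 2) * (g * w 2) - (g * z 3) * (g * w 1))"

text \<open>Moving the first row and the first column to the end gives the rotated matrix up to one
  adjustment: off the diagonal, the moved row gains a factor \<open>g\<close> and the moved column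
  loses one. The two effects cancel in the determinant.\<close>

lemma twisted_det_rotate: "twisted_det g y z w x = twisted_det g x y z w"
  by (simp add: twisted_det_def algebra_simps)

lemma twisted_det_scale:
  "twisted_det g (\<lambda>l. p * x l) (\<lambda>l. q * y l) (\<lambda>l. r * z l) (\<lambda>l. s * w l)
    = p * q * r * s * twisted_det g x y z w"
  by (simp add: twisted_det_def algebra_simps)

definition code_det :: "(nat \<Rightarrow> complex) \<Rightarrow> complex" where
  "code_det x = twisted_det \<i> x (conj_map \<circ> x) (conj_map \<circ> conj_map \<circ> x)
     (conj_map \<circ> conj_map \<circ> conj_map \<circ> x)"

lemma code_det_cong: "(\<And>l. l < 4 \<Longrightarrow> x l = y l) \<Longrightarrow> code_det x = code_det y"
  by (simp add: code_det_def twisted_det_def)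

lemma code_det_scale:
  assumes "p \<in> theta_field" "\<And>l. l < 4 \<Longrightarrow> x l \<in> theta_field"
  shows "code_det (\<lambda>l. p * x l) = rel_norm p * code_det x"
proof -
  \<comment> \<open>Padding with 0 puts every index into the field, as the unconditional rewriting
    of conjugates requires; \<open>code_det\<close> reads only indices below 4.\<close>
  define y where "y = (\<lambda>l. if l < 4 then x l else 0)"
  have y: "y l \<in> theta_field" for l
    using assms(2) by (simp add: y_def theta_field_gaussian_rats gaussian_rats_0)
  have "code_det (\<lambda>l. p * x l) = code_det (\<lambda>l. p * y l)"
    by (rule code_det_cong) (simp add: y_def)
  also have "\<dots> = twisted_det \<i> (\<lambda>l. p * y l) (\<lambda>l. conj_map p * conj_map (y l))
      (\<lambda>l. conj_map (conj_map p) * conj_map (conj_map (y l)))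
      (\<lambda>l. conj_map (conj_map (conj_map p)) * conj_map (conj_map (conj_map (y l))))"
    by (simp add: code_det_def comp_def conj_map_mult conj_map_closed assms(1) y)
  also have "\<dots> = rel_norm p * code_det y"
    unfolding twisted_det_scale by (simp add: rel_norm_def code_det_def comp_def)
  also have "code_det y = code_det x"
    by (rule code_det_cong) (simp add: y_def)
  finally show ?thesis .
qed

lemma conj_map_twisted_det:
  assumes "\<And>l. x l \<in> theta_field" "\<And>l. y l \<in> theta_field" "\<And>l. z l \<in> theta_field"
    "\<And>l. w l \<in> theta_field"
  shows "conj_map (twisted_det \<i> x y z w)
    = twisted_det \<i> (conj_map \<circ> x) (conj_map \<circ> y) (conj_map \<circ> z) (conj_map \<circ> w)"
  unfolding twisted_det_def
  by (simp add: assms conj_map_add conj_map_diff conj_map_mult theta_field_mult theta_field_add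
      theta_field_diff theta_field_gaussian_rats gaussian_rats_i conj_map_gaussian_rats)

lemma twisted_det_theta_ints:
  assumes "\<And>l. l < 4 \<Longrightarrow> x l \<in> theta_ints" "\<And>l. l < 4 \<Longrightarrow> y l \<in> theta_ints"
    "\<And>l. l < 4 \<Longrightarrow> z l \<in> theta_ints" "\<And>l. l < 4 \<Longrightarrow> w l \<in> theta_ints" "g \<in> theta_ints"
  shows "twisted_det g x y z w \<in> theta_ints"
  unfolding twisted_det_def
  by (intro theta_ints_add theta_ints_diff theta_ints_mult assms) simp_all

text \<open>\<open>conj_map\<close> moves each row to the next conjugate, which
  \<open>twisted_det_rotate\<close> undoes; so the determinant is a fixed algebraic integer.\<close>

lemma code_det_gaussian_ints:
  assumes "\<And>l. l < 4 \<Longrightarrow> x l \<in> theta_ints"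
  shows "code_det x \<in> gaussian_ints"
proof -
  define y where "y = (\<lambda>l. if l < 4 then x l else 0)"
  have yi: "y l \<in> theta_ints" for l
    using assms by (simp add: y_def theta_ints_gaussian gaussian_ints_0)
  then have y: "y l \<in> theta_field" for l by (simp add: theta_ints_def)
  have "code_det y \<in> theta_ints"
    unfolding code_det_def
    by (intro twisted_det_theta_ints) (simp_all add: yi conj_map_theta_ints theta_ints_gaussian gaussian_ints_i)
  moreover have "conj_map (code_det y) = code_det y"
    unfolding code_det_def
    by (subst conj_map_twisted_det)
      (simp_all add: y conj_map_closed comp_def conj_map_order_4 twisted_det_rotate[where x = y])
  ultimately have "code_det y \<in> gaussian_ints"
    using conj_map_fixed by (auto simp: theta_ints_def gaussian_ints_iff)
  moreover have "code_det y = code_det x" by (rule code_det_cong) (simp add: y_def)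
  ultimately show ?thesis by simp
qed

lemma twisted_det_of_int:
  "of_int (twisted_det g x y z w)
    = (twisted_det (of_int g) (of_int \<circ> x) (of_int \<circ> y) (of_int \<circ> z) (of_int \<circ> w) :: complex)"
  by (simp add: twisted_det_def)


subsection \<open>Reduction modulo \<open>\<theta> + 1\<close>\<close>

text \<open>The ring is a parameter because congruences are used both in the integers of K and in
  Z[i]. Membership of both sides is included so that congruences can be multiplied.\<close>

definition cong_in :: "complex set \<Rightarrow> complex \<Rightarrow> complex \<Rightarrow> complex \<Rightarrow> bool" where
  "cong_in A m x y \<longleftrightarrow> x \<in> A \<and> y \<in> A \<and> (\<exists>q\<in>A. x - y = m * q)"

locale complex_subring =
  fixes A :: "complex set"
  assumes add: "x \<in> A \<Longrightarrow> y \<in> A \<Longrightarrow> x + y \<in> A"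
    and diff: "x \<in> A \<Longrightarrow> y \<in> A \<Longrightarrow> x - y \<in> A"
    and mult: "x \<in> A \<Longrightarrow> y \<in> A \<Longrightarrow> x * y \<in> A"
begin

lemma cong_refl: "x \<in> A \<Longrightarrow> cong_in A m x x"
  using diff[of x x] by (auto simp: cong_in_def intro!: bexI[of _ 0])

lemma cong_add: "cong_in A m x x' \<Longrightarrow> cong_in A m y y' \<Longrightarrow> cong_in A m (x + y) (x' + y')"
  unfolding cong_in_def
proof (elim conjE bexE, intro conjI)
  fix p q assume "x - x' = m * p" "y - y' = m * q" "p \<in> A" "q \<in> A"
  then show "\<exists>r\<in>A. x + y - (x' + y') = m * r"
    by (intro bexI[of _ "p + q"]) (simp_all add: algebra_simps add)
qed (auto intro: add)

lemma cong_diff: "cong_in A m x x' \<Longrightarrow> cong_in A m y y' \<Longrightarrow> cong_in A m (x - y) (x' - y')"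
  unfolding cong_in_def
proof (elim conjE bexE, intro conjI)
  fix p q assume "x - x' = m * p" "y - y' = m * q" "p \<in> A" "q \<in> A"
  then show "\<exists>r\<in>A. x - y - (x' - y') = m * r"
    by (intro bexI[of _ "p - q"]) (simp_all add: algebra_simps diff)
qed (auto intro: diff)

lemma cong_mult: "cong_in A m x x' \<Longrightarrow> cong_in A m y y' \<Longrightarrow> cong_in A m (x * y) (x' * y')"
  unfolding cong_in_def
proof (elim conjE bexE, intro conjI)
  fix p q assume *: "x - x' = m * p" "y - y' = m * q" "p \<in> A" "q \<in> A" and A: "x \<in> A" "y' \<in> A"
  have "x * y - x' * y' = x * (y - y') + (x - x') * y'" by (simp add: algebra_simps)
  also have "\<dots> = m * (x * q + p * y')" unfolding * by (simp add: algebra_simps)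
  finally show "\<exists>r\<in>A. x * y - x' * y' = m * r"
    by (rule bexI) (intro add mult * A)
qed (auto intro: mult)

lemma cong_twisted_det:
  assumes "\<And>l. l < 4 \<Longrightarrow> cong_in A m (x l) (x' l)" "\<And>l. l < 4 \<Longrightarrow> cong_in A m (y l) (y' l)"
    "\<And>l. l < 4 \<Longrightarrow> cong_in A m (z l) (z' l)" "\<And>l. l < 4 \<Longrightarrow> cong_in A m (w l) (w' l)"
    "cong_in A m g g'"
  shows "cong_in A m (twisted_det g x y z w) (twisted_det g' x' y' z' w')"
  unfolding twisted_det_def
  by (intro cong_add cong_diff cong_mult assms) simp_all

end

interpretation theta_ints: complex_subring theta_ints
  by unfold_locales (fact theta_ints_add theta_ints_diff theta_ints_mult)+

interpretation gaussian_ints: complex_subring gaussian_ints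
  by unfold_locales (fact gaussian_ints_add gaussian_ints_diff gaussian_ints_mult)+

text \<open>\<open>\<plusminus>2\<close> is not a square modulo \<open>5\<close>.\<close>

lemma five_dvd_square_diff:
  fixes g x y :: int
  assumes g: "g = 2 \<or> g = - 2" and dvd: "5 dvd x\<^sup>2 - g * y\<^sup>2"
  shows "5 dvd x \<and> 5 dvd y"
proof -
  \<comment> \<open>Squares modulo 5 are 0, 1 and 4, whereas \<open>g\<close> times 1 or 4 is 2 or
    3.\<close>
  have sq: "\<exists>q. (u :: int)\<^sup>2 = 5 * q \<and> 5 dvd u \<or> u\<^sup>2 = 5 * q + 1 \<or> u\<^sup>2 = 5 * q + 4" for u
  proof -
    define k where "k = u div 5"
    have "u = 5 * k + u mod 5" by (simp add: k_def)
    moreover have "u mod 5 \<in> {0, 1, 2, 3, 4}" by auto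
    ultimately consider "u = 5 * k" | "u = 5 * k + 1" | "u = 5 * k + 2" | "u = 5 * k + 3" | "u = 5 * k + 4"
      by auto
    then show ?thesis
    proof cases
      case 1 then show ?thesis by (intro exI[of _ "5 * k\<^sup>2"]) (simp add: power2_eq_square)
    next
      case 2 then show ?thesis
        by (intro exI[of _ "5 * k\<^sup>2 + 2 * k"]) (simp add: power2_eq_square algebra_simps)
    next
      case 3 then show ?thesis
        by (intro exI[of _ "5 * k\<^sup>2 + 4 * k"]) (simp add: power2_eq_square algebra_simps)
    next
      case 4 then show ?thesis
        by (intro exI[of _ "5 * k\<^sup>2 + 6 * k + 1"]) (simp add: power2_eq_square algebra_simps)
    next
      case 5 then show ?thesis
        by (intro exI[of _ "5 * k\<^sup>2 + 8 * k + 3"]) (simp add: power2_eq_square algebra_simps)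
    qed
  qed
  obtain p where p: "x\<^sup>2 = 5 * p \<and> 5 dvd x \<or> x\<^sup>2 = 5 * p + 1 \<or> x\<^sup>2 = 5 * p + 4" using sq by blast
  obtain q where q: "y\<^sup>2 = 5 * q \<and> 5 dvd y \<or> y\<^sup>2 = 5 * q + 1 \<or> y\<^sup>2 = 5 * q + 4" using sq by blast
  show ?thesis using g dvd p q by (elim disjE) (simp_all, presburger+)
qed

text \<open>For \<open>g = \<plusminus>2\<close> the polynomial \<open>X\<^sup>4 - g\<close> is irreducible modulo \<open>5\<close>, and
  \<open>twisted_det g n n n n\<close> is the norm of \<open>n\<^sub>0 + n\<^sub>1 X + n\<^sub>2 X\<^sup>2 + n\<^sub>3 X\<^sup>3\<close>; it is computed through the
  intermediate field generated by \<open>X\<^sup>2\<close>.\<close>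

lemma five_dvd_twisted_det:
  fixes g :: int and n :: "nat \<Rightarrow> int"
  assumes g: "g = 2 \<or> g = - 2" and dvd: "5 dvd twisted_det g n n n n" and "l < 4"
  shows "5 dvd n l"
proof -
  \<comment> \<open>With Y = X^2, A = n_0 + n_2 Y and B = n_1 + n_3 Y, the element is A + X B. Its
    norm to the intermediate field is A^2 - Y B^2 = U + V Y, and P and Q are the norms of A and
    B.\<close>
  define U where "U = (n 0)\<^sup>2 + g * (n 2)\<^sup>2 - 2 * g * n 1 * n 3"
  define V where "V = 2 * n 0 * n 2 - (n 1)\<^sup>2 - g * (n 3)\<^sup>2"
  define P where "P = (n 0)\<^sup>2 - g * (n 2)\<^sup>2"
  define Q where "Q = (n 1)\<^sup>2 - g * (n 3)\<^sup>2"
  have "twisted_det g n n n n = U\<^sup>2 - g * V\<^sup>2"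
    by (simp add: twisted_det_def U_def V_def power2_eq_square algebra_simps)
  with dvd have UV: "5 dvd U" "5 dvd V" using five_dvd_square_diff[OF g, of U V] by auto
  \<comment> \<open>If U and V vanish modulo 5, then A^2 = Y B^2, and norms give P^2 = -g Q^2
    because Y has norm -g. The cofactors are those of the difference of squares applied to each
    coordinate of A^2 and Y B^2.\<close>
  have "P\<^sup>2 - (- g) * Q\<^sup>2
    = U * ((n 0)\<^sup>2 + g * (n 2)\<^sup>2 + 2 * g * n 1 * n 3)
      + V * (- g * (2 * n 0 * n 2 + (n 1)\<^sup>2 + g * (n 3)\<^sup>2))"
    by (simp add: P_def Q_def U_def V_def power2_eq_square algebra_simps)
  then have "5 dvd P\<^sup>2 - (- g) * Q\<^sup>2" using UV by (simp only: dvd_add dvd_mult2)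
  moreover have "- g = 2 \<or> - g = - 2" using g by auto
  ultimately have PQ: "5 dvd P" "5 dvd Q" using five_dvd_square_diff by blast+
  have "5 dvd n 0" "5 dvd n 2" "5 dvd n 1" "5 dvd n 3"
    using five_dvd_square_diff[OF g] PQ unfolding P_def Q_def by blast+
  then show ?thesis using less_4_cases[OF assms(3)] by auto
qed

text \<open>For q = c + d i, the imaginary part gives c = g d, and then the real part gives k =
  -(g^2 + 1) d = -5 d.\<close>

lemma int_dvd_of_gaussian_dvd:
  assumes g: "g = 2 \<or> g = - 2" and eq: "of_int k = (\<i> - of_int g) * q" and q: "q \<in> gaussian_ints"
  shows "(5 :: int) dvd k"
proof -
  obtain c d where cd: "q = of_int c + of_int d * \<i>" using q by (auto simp: gaussian_ints_def)
  have "(of_int k :: real) = of_int (- g * c - d)" "(0 :: real) = of_int (c - g * d)"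
    using eq by (simp_all add: cd complex_eq_iff)
  then have "k = - g * c - d" "c = g * d" by linarith+
  then show ?thesis using g by auto
qed

text \<open>Both primes \<open>\<i> \<mp> 2\<close> over \<open>5\<close> of the Gaussian integers have residue field \<open>\<int> / 5\<close>, in
  which \<open>\<i>\<close> has order \<open>4\<close>.\<close>

lemma dvd_gaussian_twisted_det:
  assumes g: "g = 2 \<or> g = - 2"
    and dvd: "twisted_det \<i> a a a a ^ 4 = 5 * q" "q \<in> gaussian_ints"
    and a: "\<And>l. l < 4 \<Longrightarrow> a l = of_int (u l) + of_int (v l) * \<i>" and "l < 4"
  shows "5 dvd u l + g * v l"
proof -
  let ?m = "\<i> - of_int g"
  \<comment> \<open>The residues of the \<open>a l\<close> under \<i> -> g.\<close>
  define n where "n = (\<lambda>l. u l + g * v l)"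
  have i: "cong_in gaussian_ints ?m \<i> (of_int g)"
    unfolding cong_in_def by (auto simp: gaussian_ints_intros intro!: bexI[of _ 1])
  have an: "cong_in gaussian_ints ?m (a l) (of_int (n l))" if "l < 4" for l
    unfolding cong_in_def n_def a[OF that]
    by (auto simp: gaussian_ints_intros algebra_simps intro!: bexI[of _ "of_int (v l)"])
  have "cong_in gaussian_ints ?m (twisted_det \<i> a a a a)
      (twisted_det (of_int g) (of_int \<circ> n) (of_int \<circ> n) (of_int \<circ> n) (of_int \<circ> n))"
    by (intro gaussian_ints.cong_twisted_det i) (auto intro: an)
  then have c: "cong_in gaussian_ints ?m (twisted_det \<i> a a a a) (of_int (twisted_det g n n n n))"
    by (simp only: twisted_det_of_int)
  let ?D = "twisted_det g n n n n"
  note c2 = gaussian_ints.cong_mult[OF c c]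
  have "cong_in gaussian_ints ?m (twisted_det \<i> a a a a ^ 4) (of_int (?D ^ 4))"
    using gaussian_ints.cong_mult[OF c2 c2] by (simp add: power4_eq_xxxx mult.assoc)
  then obtain r where r: "r \<in> gaussian_ints" "5 * q - of_int (?D ^ 4) = ?m * r"
    unfolding cong_in_def dvd(1) by blast
  \<comment> \<open>The norm of \<open>\<i> - of_int g\<close> is 1 + g^2 = 5, so a multiple of 5
    vanishes modulo this prime.\<close>
  have five: "5 = ?m * (- \<i> - of_int g)" using g by (auto simp: algebra_simps)
  have "of_int (?D ^ 4) = 5 * q - ?m * r" using r(2) by (simp add: algebra_simps)
  also have "5 * q = ?m * ((- \<i> - of_int g) * q)" by (subst five) (rule mult.assoc)
  also have "\<dots> - ?m * r = ?m * ((- \<i> - of_int g) * q - r)" by (rule right_diff_distrib[symmetric])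
  finally have "5 dvd ?D ^ 4"
    by (rule int_dvd_of_gaussian_dvd[OF g]) (intro gaussian_ints_intros dvd(2) r(1))
  then have "5 dvd ?D" by (rule prime_dvd_power[rotated]) simp
  then have "5 dvd n l" using five_dvd_twisted_det[OF g _ \<open>l < 4\<close>] by blast
  then show ?thesis by (simp add: n_def)
qed

text \<open>The order Z[i][\<theta>]. It contains all layers, and its coordinates make residues
  modulo \<open>theta + 1\<close> explicit, so the descent can stay inside it.\<close>

definition gaussian_theta_ints :: "complex set" where
  "gaussian_theta_ints = {cubic theta a b c d | a b c d.
     a \<in> gaussian_ints \<and> b \<in> gaussian_ints \<and> c \<in> gaussian_ints \<and> d \<in> gaussian_ints}"

lemma gaussian_theta_ints_I: "a \<in> gaussian_ints \<Longrightarrow> b \<in> gaussian_ints \<Longrightarrow> c \<in> gaussian_ints \<Longrightarrow>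
    d \<in> gaussian_ints \<Longrightarrow> cubic theta a b c d \<in> gaussian_theta_ints"
  by (auto simp: gaussian_theta_ints_def)

lemma gaussian_theta_ints_E:
  assumes "x \<in> gaussian_theta_ints"
  obtains a b c d where "x = cubic theta a b c d"
    "a \<in> gaussian_ints" "b \<in> gaussian_ints" "c \<in> gaussian_ints" "d \<in> gaussian_ints"
  using assms by (auto simp: gaussian_theta_ints_def)

lemma gaussian_theta_ints_add:
  "x \<in> gaussian_theta_ints \<Longrightarrow> y \<in> gaussian_theta_ints \<Longrightarrow> x + y \<in> gaussian_theta_ints"
  by (elim gaussian_theta_ints_E) (simp add: cubic_add gaussian_theta_ints_I gaussian_ints_add)

lemma gaussian_theta_ints_mult:
  "x \<in> gaussian_theta_ints \<Longrightarrow> y \<in> gaussian_theta_ints \<Longrightarrow> x * y \<in> gaussian_theta_ints"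
  by (elim gaussian_theta_ints_E)
    (simp add: cubic_theta_mult_reduced gaussian_theta_ints_I gaussian_ints_intros)

lemma gaussian_theta_ints_gaussian: "x \<in> gaussian_ints \<Longrightarrow> x \<in> gaussian_theta_ints"
  using gaussian_theta_ints_I[of x 0 0 0] by (simp add: cubic_def gaussian_ints_0)

lemma gaussian_theta_ints_theta_ints: "x \<in> gaussian_theta_ints \<Longrightarrow> x \<in> theta_ints"
  by (elim gaussian_theta_ints_E) (simp add: cubic_def theta_ints_intros)

lemma theta_shift_theta_ints: "theta + 1 \<in> theta_ints"
  by (intro theta_ints_intros)

text \<open>The conjugate is \<open>theta\<^sup>2 - 1\<close>, which factors. This stability is the
  only part of total ramification needed to make conjugation trivial on residues.\<close>

lemma conj_map_theta_shift: "\<exists>q\<in>theta_ints. conj_map (theta + 1) = (theta + 1) * q"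
  by (rule bexI[of _ "theta - 1"])
    (simp_all add: conj_map_add theta_field_theta theta_field_gaussian_rats gaussian_rats_1
      conj_map_theta conj_map_gaussian_rats theta_ints_intros algebra_simps power2_eq_square)

text \<open>The Gaussian residue is fixed by \<open>conj_map\<close>, and the error term remains a
  multiple of \<open>theta + 1\<close>.\<close>

lemma cong_conj_map:
  assumes "cong_in theta_ints (theta + 1) x a" "a \<in> gaussian_ints"
  shows "cong_in theta_ints (theta + 1) (conj_map x) a"
proof -
  obtain q where q: "q \<in> theta_ints" "x - a = (theta + 1) * q" and x: "x \<in> theta_ints"
    using assms(1) by (auto simp: cong_in_def)
  obtain p where p: "p \<in> theta_ints" "conj_map (theta + 1) = (theta + 1) * p"
    using conj_map_theta_shift by blast
  have F: "x \<in> theta_field" "q \<in> theta_field" "theta + 1 \<in> theta_field" "a \<in> theta_field"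
    using x q(1) theta_shift_theta_ints theta_ints_gaussian[OF assms(2)] by (auto simp: theta_ints_def)
  have "conj_map x - a = conj_map (x - a)"
    using F assms(2) by (simp add: conj_map_diff conj_map_gaussian_rats gaussian_ints_rats)
  also have "\<dots> = (theta + 1) * (p * conj_map q)"
    unfolding q(2) using F p(2) by (simp add: conj_map_mult mult.assoc)
  finally show ?thesis
    unfolding cong_in_def using conj_map_theta_ints[OF x] theta_ints_gaussian[OF assms(2)]
      theta_ints_mult[OF p(1) conj_map_theta_ints[OF q(1)]]
    by blast
qed

text \<open>Polynomial division by \<open>theta + 1\<close>; the remainder is the value at
  -1.\<close>

lemma theta_shift_residue:
  assumes "x \<in> gaussian_theta_ints"
  obtains a q where "a \<in> gaussian_ints" "q \<in> gaussian_theta_ints" "x = a + (theta + 1) * q"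
proof -
  obtain a b c d where x: "x = cubic theta a b c d"
    and g: "a \<in> gaussian_ints" "b \<in> gaussian_ints" "c \<in> gaussian_ints" "d \<in> gaussian_ints"
    using assms by (rule gaussian_theta_ints_E)
  show ?thesis
  proof (rule that)
    show "a - b + c - d \<in> gaussian_ints" by (intro gaussian_ints_intros g)
    show "cubic theta (b - c + d) (c - d) d 0 \<in> gaussian_theta_ints"
      by (intro gaussian_theta_ints_I gaussian_ints_intros g)
    show "x = a - b + c - d + (theta + 1) * cubic theta (b - c + d) (c - d) d 0"
      by (simp add: x cubic_def algebra_simps eval_nat_numeral)
  qed
qed

lemma rel_norm_theta_shift: "rel_norm (theta + 1) = - 5"
proof -
  have e: "theta + 1 = cubic theta 1 1 0 0" by (simp add: cubic_def)
  show ?thesis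
    unfolding e rel_norm_def
    by (simp add: conj_map_coords gaussian_rats_intros) (simp add: cubic_def theta_simps)
qed

lemma five_theta_shift_dvd: "\<exists>s\<in>gaussian_theta_ints. 5 = (theta + 1) * s"
proof
  have t: "cubic theta 1 1 0 0 = theta + 1" by (simp add: cubic_def)
  let ?s = "(theta + 1) * ((theta + 1) * ((theta + 1) * cubic theta 11 (- 9) (- 2) 2))"
  show "5 = (theta + 1) * ?s"
    by (subst five_theta_shift) (simp add: cubic_def eval_nat_numeral mult.assoc)
  show "?s \<in> gaussian_theta_ints"
    unfolding t[symmetric]
    by (intro gaussian_theta_ints_mult gaussian_theta_ints_I gaussian_ints_intros)
qed

lemma code_det_0_descent:
  assumes x: "\<And>l. l < 4 \<Longrightarrow> x l \<in> gaussian_theta_ints" and det: "code_det x = 0" and "l < 4"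
  shows "\<exists>y\<in>gaussian_theta_ints. x l = (theta + 1) * y"
proof -
  have "\<forall>l\<in>{..<4}. \<exists>a q. a \<in> gaussian_ints \<and> q \<in> gaussian_theta_ints \<and> x l = a + (theta + 1) * q"
    using x theta_shift_residue by (metis lessThan_iff)
  then obtain a q where a: "\<And>l. l < 4 \<Longrightarrow> a l \<in> gaussian_ints"
    and q: "\<And>l. l < 4 \<Longrightarrow> q l \<in> gaussian_theta_ints"
    and xaq: "\<And>l. l < 4 \<Longrightarrow> x l = a l + (theta + 1) * q l"
    by (metis lessThan_iff)
  have c0: "cong_in theta_ints (theta + 1) (x l) (a l)" if "l < 4" for l
    using that a[of l] q[of l] x[of l] xaq[of l]
    by (auto simp: cong_in_def theta_ints_gaussian gaussian_theta_ints_theta_ints)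
  have "cong_in theta_ints (theta + 1) (code_det x) (twisted_det \<i> a a a a)"
    unfolding code_det_def
    by (rule theta_ints.cong_twisted_det)
      (auto intro!: cong_conj_map c0 a theta_ints.cong_refl theta_ints_gaussian gaussian_ints_i)
  then obtain r where r: "r \<in> theta_ints" "- twisted_det \<i> a a a a = (theta + 1) * r"
    by (auto simp: cong_in_def det)
  have D: "twisted_det \<i> a a a a \<in> gaussian_ints"
    unfolding twisted_det_def by (intro gaussian_ints_intros a) simp_all
  \<comment> \<open>The relative norm of a Gaussian integer is its fourth power, and that of
    \<open>theta + 1\<close> is -5. Taking norms thus turns divisibility by \<open>theta + 1\<close>
    in the integers of K into divisibility by 5 in Z[i].\<close>
  then have "rel_norm (twisted_det \<i> a a a a) = twisted_det \<i> a a a a ^ 4"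
    by (simp add: rel_norm_def conj_map_gaussian_rats gaussian_ints_rats power4_eq_xxxx)
  moreover have "twisted_det \<i> a a a a = (theta + 1) * (- r)" using r(2) by (metis minus_mult_right minus_minus)
  moreover have "- r \<in> theta_ints" using theta_ints_diff[OF theta_ints_gaussian[OF gaussian_ints_0] r(1)] by simp
  ultimately have D4: "twisted_det \<i> a a a a ^ 4 = 5 * (- rel_norm (- r))"
    using theta_shift_theta_ints
    by (metis (no_types, lifting) theta_ints_def mem_Collect_eq rel_norm_mult rel_norm_theta_shift
        minus_mult_left minus_mult_right)
  have rn: "- rel_norm (- r) \<in> gaussian_ints"
    by (intro gaussian_ints_uminus rel_norm_gaussian_ints) fact
  have "\<forall>l\<in>{..<4}. \<exists>u v. a l = of_int u + of_int v * \<i>" using a by (force simp: gaussian_ints_def)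
  then obtain u v where uv: "\<And>l. l < 4 \<Longrightarrow> a l = of_int (u l) + of_int (v l) * \<i>"
    by (metis lessThan_iff)
  \<comment> \<open>One residue vanishes at each of the two primes above 5; their sum and difference
    isolate 2u and 4v.\<close>
  have "5 dvd u l + 2 * v l" "5 dvd u l + (- 2) * v l"
    using dvd_gaussian_twisted_det[OF _ D4 rn uv \<open>l < 4\<close>] by blast+
  then have "5 dvd u l" "5 dvd v l" by presburger+
  then obtain u' v' where "u l = 5 * u'" "v l = 5 * v'" by (auto elim!: dvdE)
  then have al: "a l = 5 * (of_int u' + of_int v' * \<i>)" using uv[OF \<open>l < 4\<close>] by (simp add: algebra_simps)
  obtain s where s: "s \<in> gaussian_theta_ints" "5 = (theta + 1) * s"
    using five_theta_shift_dvd by blast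
  \<comment> \<open>As 5 is a multiple of \<open>theta + 1\<close> within the order, the residue can
    be absorbed into the quotient.\<close>
  have "x l = (theta + 1) * (s * (of_int u' + of_int v' * \<i>) + q l)"
    using xaq[OF \<open>l < 4\<close>] unfolding al s(2) by (simp only: distrib_left mult.assoc)
  moreover have "s * (of_int u' + of_int v' * \<i>) + q l \<in> gaussian_theta_ints"
    by (rule gaussian_theta_ints_add[OF gaussian_theta_ints_mult[OF s(1)
          gaussian_theta_ints_gaussian[OF gaussian_ints_I]] q[OF \<open>l < 4\<close>]])
  ultimately show ?thesis by blast
qed

text \<open>Dividing all layers by \<open>theta + 1\<close> divides the determinant by -5, so it is
  still 0 and the descent step applies again.\<close>

lemma code_det_0_power_dvd:
  assumes "\<And>l. l < 4 \<Longrightarrow> x l \<in> gaussian_theta_ints" "code_det x = 0" "l < 4"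
  shows "\<exists>y\<in>gaussian_theta_ints. x l = (theta + 1) ^ n * y"
  using assms
proof (induction n arbitrary: x l)
  case (Suc n)
  have "\<forall>l\<in>{..<4}. \<exists>y\<in>gaussian_theta_ints. x l = (theta + 1) * y"
    using code_det_0_descent[OF Suc.prems(1,2)] by auto
  then obtain y where y: "\<And>l. l < 4 \<Longrightarrow> y l \<in> gaussian_theta_ints"
    "\<And>l. l < 4 \<Longrightarrow> x l = (theta + 1) * y l"
    by (metis lessThan_iff)
  have "code_det x = code_det (\<lambda>l. (theta + 1) * y l)" by (rule code_det_cong) (rule y(2))
  also have "\<dots> = rel_norm (theta + 1) * code_det y"
    using y(1) theta_shift_theta_ints gaussian_theta_ints_theta_ints
    by (intro code_det_scale) (auto simp: theta_ints_def)
  finally have "code_det y = 0" using Suc.prems(2) by (simp add: rel_norm_theta_shift)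
  from Suc.IH[OF y(1) this Suc.prems(3)] obtain z
    where "z \<in> gaussian_theta_ints" "y l = (theta + 1) ^ n * z" by blast
  then show ?case using y(2)[OF Suc.prems(3)] by (auto intro!: bexI[of _ z] simp: mult.assoc)
qed auto

lemma gaussian_int_norm_ge_1:
  assumes "x \<in> gaussian_ints" "x \<noteq> 0" shows "cmod x \<ge> 1"
proof -
  obtain a b where x: "x = of_int a + of_int b * \<i>" using assms(1) by (auto simp: gaussian_ints_def)
  have "(cmod x)\<^sup>2 = of_int (a\<^sup>2 + b\<^sup>2)" by (simp add: x cmod_power2)
  moreover have "a\<^sup>2 + b\<^sup>2 \<noteq> 0" using assms(2) by (auto simp: x)
  then have "a\<^sup>2 + b\<^sup>2 \<ge> 1" by (smt (verit) zero_le_power2)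
  then have "(of_int (a\<^sup>2 + b\<^sup>2) :: real) \<ge> 1" by linarith
  ultimately have "(cmod x)\<^sup>2 \<ge> 1\<^sup>2" by simp
  then show ?thesis by (rule power2_le_imp_le) simp
qed

lemma rel_norm_power: "x \<in> theta_field \<Longrightarrow> rel_norm (x ^ n) = rel_norm x ^ n"
proof (induction n)
  case 0
  show ?case by (simp add: rel_norm_def conj_map_gaussian_rats gaussian_rats_1)
qed (simp add: rel_norm_mult theta_field_power)

text \<open>The relative norm bounds the descent: n factors \<open>theta + 1\<close> contribute 5^n,
  and the norm of the nonzero cofactor is a Gaussian integer of modulus at least 1.\<close>

lemma code_det_eq_0_imp:
  assumes x: "\<And>l. l < 4 \<Longrightarrow> x l \<in> gaussian_theta_ints" and det: "code_det x = 0" and l: "l < 4"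
  shows "x l = 0"
proof (rule ccontr)
  assume nz: "x l \<noteq> 0"
  have "5 ^ n \<le> cmod (rel_norm (x l))" for n
  proof -
    obtain y where y: "y \<in> gaussian_theta_ints" "x l = (theta + 1) ^ n * y"
      using code_det_0_power_dvd[OF x det l] by blast
    have yi: "y \<in> theta_ints" using y(1) by (rule gaussian_theta_ints_theta_ints)
    then have F: "y \<in> theta_field" "theta + 1 \<in> theta_field"
      using theta_shift_theta_ints by (auto simp: theta_ints_def)
    have "rel_norm (x l) = (- 5) ^ n * rel_norm y"
      by (simp add: y(2) rel_norm_mult rel_norm_power theta_field_power F rel_norm_theta_shift)
    moreover have "y \<noteq> 0" using nz y(2) by auto
    then have "cmod (rel_norm y) \<ge> 1"
      using F by (intro gaussian_int_norm_ge_1 rel_norm_gaussian_ints yi) (simp add: rel_norm_eq_0_iff)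
    ultimately show ?thesis by (simp add: norm_mult norm_power)
  qed
  moreover obtain n where "cmod (rel_norm (x l)) < 5 ^ n"
    using real_arch_pow[of 5 "cmod (rel_norm (x l))"] by auto
  ultimately show False by (metis not_less)
qed


subsection \<open>The code is perfect\<close>

lemma det_mat_Suc:
  fixes f :: "nat \<times> nat \<Rightarrow> 'a :: comm_ring_1"
  shows "Determinant.det (mat (Suc n) (Suc n) f) =
    (\<Sum>j<Suc n. f (0, j) * ((- 1) ^ j *
       Determinant.det (mat n n (\<lambda>(r, s). f (Suc r, if s < j then s else Suc s)))))"
proof -
  have "mat_delete (mat (Suc n) (Suc n) f) 0 j
      = mat n n (\<lambda>(r, s). f (Suc r, if s < j then s else Suc s))" for j
    unfolding mat_delete_def by (rule eq_matI) auto
  then show ?thesis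
    by (subst laplace_expansion_row[of _ "Suc n" 0]) (auto simp: cofactor_def)
qed

lemma det_mat_3:
  fixes f :: "nat \<times> nat \<Rightarrow> 'a :: comm_ring_1"
  shows "Determinant.det (mat 3 3 f) =
     f (0, 0) * (f (1, 1) * f (2, 2) - f (1, 2) * f (2, 1))
   - f (0, 1) * (f (1, 0) * f (2, 2) - f (1, 2) * f (2, 0))
   + f (0, 2) * (f (1, 0) * f (2, 1) - f (1, 1) * f (2, 0))"
proof -
  have 3: "(3 :: nat) = Suc (Suc (Suc 0))" by simp
  show ?thesis
    unfolding 3 det_mat_Suc by (simp add: lessThan_Suc numeral_eq_Suc algebra_simps)
qed

lemma det_mat_4:
  fixes f :: "nat \<times> nat \<Rightarrow> 'a :: comm_ring_1"
  shows "Determinant.det (mat 4 4 f) =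
     (f (0, 0) * f (1, 1) - f (0, 1) * f (1, 0)) * (f (2, 2) * f (3, 3) - f (2, 3) * f (3, 2))
   - (f (0, 0) * f (1, 2) - f (0, 2) * f (1, 0)) * (f (2, 1) * f (3, 3) - f (2, 3) * f (3, 1))
   + (f (0, 0) * f (1, 3) - f (0, 3) * f (1, 0)) * (f (2, 1) * f (3, 2) - f (2, 2) * f (3, 1))
   + (f (0, 1) * f (1, 2) - f (0, 2) * f (1, 1)) * (f (2, 0) * f (3, 3) - f (2, 3) * f (3, 0))
   - (f (0, 1) * f (1, 3) - f (0, 3) * f (1, 1)) * (f (2, 0) * f (3, 2) - f (2, 2) * f (3, 0))
   + (f (0, 2) * f (1, 3) - f (0, 3) * f (1, 2)) * (f (2, 0) * f (3, 1) - f (2, 1) * f (3, 0))"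
proof -
  have 4: "(4 :: nat) = Suc 3" by simp
  show ?thesis
    unfolding 4 det_mat_Suc det_mat_3
    by (simp add: lessThan_Suc numeral_eq_Suc algebra_simps)
qed

lemma det_codeword_mat:
  "Determinant.det (mat 4 4 (\<lambda>(r, s). if r \<le> s then h r (s - r) else g * h r (s + 4 - r)))
    = twisted_det g (h 0) (h 1) (h 2) (h 3)"
  unfolding det_mat_4 twisted_det_def by simp

section \<open>Codewords and the conditions for perfection\<close>

definition nus :: "complex list" where
  "nus = [nu 0, nu 1, nu 2, nu 3]"

lemma length_nus: "length nus = 4"
  by (simp add: nus_def)

lemma layer_nus: "layer nus u l = (\<Sum>k<4. u l k * nu k)"
  unfolding layer_def length_nus by (rule sum.cong) (simp_all only: lessThan_iff nu_nth nus_def)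

lemma symbol_arrays_gaussian:
  "u \<in> symbol_arrays gaussian_rats 4 \<longleftrightarrow> (\<forall>l<4. \<forall>k<4. u l k \<in> gaussian_ints)"
  by (simp add: symbol_arrays_def gaussian_ints_carrier)

lemma nu_gaussian_theta_ints: "k < 4 \<Longrightarrow> nu k \<in> gaussian_theta_ints"
  by (drule less_4_cases) (auto simp: nu_cubic intro!: gaussian_theta_ints_I gaussian_ints_intros)

lemma gaussian_theta_ints_sum:
  "(\<And>k. k \<in> S \<Longrightarrow> f k \<in> gaussian_theta_ints) \<Longrightarrow> sum f S \<in> gaussian_theta_ints"
  by (induction S rule: infinite_finite_induct)
    (auto intro: gaussian_theta_ints_add gaussian_theta_ints_gaussian gaussian_ints_0)

lemma layer_gaussian_theta_ints:
  assumes "u \<in> symbol_arrays gaussian_rats 4" "l < 4"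
  shows "layer nus u l \<in> gaussian_theta_ints"
  unfolding layer_nus
  by (rule gaussian_theta_ints_sum)
    (use assms in \<open>auto simp: symbol_arrays_gaussian gaussian_theta_ints_mult
       gaussian_theta_ints_gaussian nu_gaussian_theta_ints\<close>)

lemma layer_field:
  assumes "u \<in> symbol_arrays gaussian_rats 4" "l < 4"
  shows "layer nus u l \<in> theta_field"
  using gaussian_theta_ints_theta_ints[OF layer_gaussian_theta_ints[OF assms]]
  by (simp add: theta_ints_def)

lemma codeword_nus:
  assumes "u \<in> symbol_arrays gaussian_rats 4"
  shows "codeword (conj_auto 1) \<i> nus c u = complex_of_real (1 / sqrt c) \<cdot>\<^sub>m
    mat 4 4 (\<lambda>(r, s). if r \<le> s then (conj_map ^^ r) (layer nus u (s - r))
      else \<i> * (conj_map ^^ r) (layer nus u (s + 4 - r)))"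
  unfolding codeword_def length_nus
  by (rule arg_cong[where f = "\<lambda>A. _ \<cdot>\<^sub>m A"], rule eq_matI)
    (auto simp del: One_nat_def simp: funpow_conj_auto layer_field assms)

lemma code_full_rate:
  assumes "c > 0" shows "full_rate gaussian_rats (conj_auto 1) \<i> nus c"
  unfolding full_rate_def length_nus
proof (intro ballI impI allI)
  fix u v l k
  assume u: "u \<in> symbol_arrays gaussian_rats 4" and v: "v \<in> symbol_arrays gaussian_rats 4"
    and eq: "codeword (conj_auto 1) \<i> nus c u = codeword (conj_auto 1) \<i> nus c v"
    and l: "l < (4 :: nat)" and k: "k < (4 :: nat)"
  \<comment> \<open>Row 0 lists the four layers, up to scaling, with neither conjugation nor a
    factor \<gamma>.\<close>
  have "codeword (conj_auto 1) \<i> nus c u $$ (0, l) = codeword (conj_auto 1) \<i> nus c v $$ (0, l)"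
    by (simp only: eq)
  then have "layer nus u l = layer nus v l"
    using l assms unfolding codeword_nus[OF u] codeword_nus[OF v] by simp
  then have "(\<Sum>j<4. (u l j - v l j) * nu j) = 0"
    unfolding layer_nus by (simp add: left_diff_distrib sum_subtractf)
  then have "u l k - v l k = 0"
    by (rule nu_independent[rotated])
      (use u v l k in \<open>auto simp: symbol_arrays_gaussian gaussian_rats_diff gaussian_ints_rats\<close>)
  then show "u l k = v l k" by simp
qed

lemma code_nonvanishing_det:
  assumes "c > 0" shows "nonvanishing_det gaussian_rats (conj_auto 1) \<i> nus c"
  unfolding nonvanishing_det_def length_nus
proof (intro exI conjI ballI impI)
  let ?m = "complex_of_real (1 / sqrt c)"
  \<comment> \<open>The bound is c^(-4): the scaling factor enters a determinant of size 4 to the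
    fourth power, and the modulus is then squared.\<close>
  show "(cmod ?m ^ 4)\<^sup>2 > 0" using assms by simp
  fix A assume "A \<in> infinite_code gaussian_rats (conj_auto 1) \<i> nus c" and nz: "A \<noteq> 0\<^sub>m 4 4"
  then obtain u where u: "u \<in> symbol_arrays gaussian_rats 4" and A: "A = codeword (conj_auto 1) \<i> nus c u"
    by (auto simp: infinite_code_def length_nus)
  define x where "x = layer nus u"
  have x: "x l \<in> gaussian_theta_ints" if "l < 4" for l
    using layer_gaussian_theta_ints[OF u that] by (simp add: x_def)
  have "Determinant.det A = ?m ^ 4 * code_det x"
    unfolding A codeword_nus[OF u] det_smult x_def[symmetric]
    using det_codeword_mat[of "\<lambda>r k. (conj_map ^^ r) (x k)" \<i>]
    by (simp add: code_det_def comp_def funpow_2_3)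
  moreover have "code_det x \<noteq> 0"
  proof
    assume "code_det x = 0"
    then have "layer nus u l = 0" if "l < 4" for l
      using code_det_eq_0_imp[of x, OF x _ that] by (simp add: x_def)
    then have "A = 0\<^sub>m 4 4"
      unfolding A codeword_nus[OF u]
      by (intro eq_matI) (auto simp: funpow_conj_map_gaussian_rats gaussian_rats_0)
    with nz show False ..
  qed
  then have "cmod (code_det x) \<ge> 1"
    using code_det_gaussian_ints[of x] x gaussian_theta_ints_theta_ints
    by (intro gaussian_int_norm_ge_1) auto
  then have "cmod ?m ^ 4 * 1 \<le> cmod ?m ^ 4 * cmod (code_det x)"
    by (intro mult_left_mono) simp_all
  ultimately have "cmod ?m ^ 4 \<le> cmod (Determinant.det A)"
    by (simp only: norm_mult norm_power mult_1_right)
  then show "(cmod ?m ^ 4)\<^sup>2 \<le> (cmod (Determinant.det A))\<^sup>2" by (rule power_mono) simp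
qed

lemma mat_adjoint_index:
  "i < dim_col A \<Longrightarrow> j < dim_row A \<Longrightarrow> mat_adjoint A $$ (i, j) = conjugate (A $$ (j, i))"
  unfolding mat_adjoint_def by (simp add: mat_of_rows_def)

lemma mat_adjoint_dim: "dim_row (mat_adjoint A) = dim_col A" "dim_col (mat_adjoint A) = dim_row A"
  by (simp_all add: mat_adjoint_def)

lemma code_unitary: "unitary_mat (layer_matrix (conj_auto 1) nus 15)"
proof -
  define U where "U = layer_matrix (conj_auto 1) nus 15"
  have U: "U \<in> carrier_mat 4 4" by (simp add: U_def layer_matrix_def length_nus)
  have dim: "dim_row U = 4" "dim_col U = 4" using U by auto
  have adj: "mat_adjoint U \<in> carrier_mat 4 4" using U by (auto simp: mat_adjoint_dim)
  have idx: "U $$ (r, k) = complex_of_real (1 / sqrt 15) * (conj_map ^^ r) (nu k)"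
    if "r < 4" "k < 4" for r k
    using that nu_nth[OF that(2)] funpow_conj_auto[OF nu_field[OF that(2)], of r]
    by (simp del: One_nat_def add: U_def layer_matrix_def length_nus nus_def)
  have "U * mat_adjoint U = 1\<^sub>m 4"
  proof (rule eq_matI)
    fix r s assume "r < dim_row (1\<^sub>m 4 :: complex mat)" "s < dim_col (1\<^sub>m 4 :: complex mat)"
    then have rs: "r < 4" "s < 4" by auto
    have "(U * mat_adjoint U) $$ (r, s) = (\<Sum>k<4. U $$ (r, k) * cnj (U $$ (s, k)))"
      using rs dim by (simp add: scalar_prod_def mat_adjoint_index mat_adjoint_dim lessThan_atLeast0
          conjugate_complex_def)
    also have "\<dots> = (\<Sum>k<4. complex_of_real (1 / 15)
        * ((conj_map ^^ r) (nu k) * cnj ((conj_map ^^ s) (nu k))))"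
    proof (rule sum.cong)
      fix k :: nat assume "k \<in> {..<4}"
      let ?m = "complex_of_real (1 / sqrt 15)"
      have m: "?m * ?m = complex_of_real (1 / 15)" unfolding of_real_mult[symmetric] by simp
      have "U $$ (r, k) * cnj (U $$ (s, k))
          = (?m * (conj_map ^^ r) (nu k)) * (?m * cnj ((conj_map ^^ s) (nu k)))"
        using \<open>k \<in> {..<4}\<close> rs
        by (simp only: idx lessThan_iff complex_cnj_mult complex_cnj_complex_of_real)
      also have "\<dots> = (?m * ?m) * ((conj_map ^^ r) (nu k) * cnj ((conj_map ^^ s) (nu k)))"
        by (simp only: mult_ac)
      finally show "U $$ (r, k) * cnj (U $$ (s, k)) = complex_of_real (1 / 15)
          * ((conj_map ^^ r) (nu k) * cnj ((conj_map ^^ s) (nu k)))"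
        unfolding m .
    qed simp
    also have "\<dots> = complex_of_real (1 / 15) * (if r = s then 15 else 0)"
      unfolding sum_distrib_left[symmetric] nu_orthogonal[OF rs] ..
    also have "\<dots> = 1\<^sub>m 4 $$ (r, s)" using rs by simp
    finally show "(U * mat_adjoint U) $$ (r, s) = 1\<^sub>m 4 $$ (r, s)" .
  qed (use dim in \<open>auto simp: mat_adjoint_dim\<close>)
  \<comment> \<open>For square matrices a right inverse is also a left inverse, so orthogonality of
    the rows suffices.\<close>
  with mat_mult_left_right_inverse[OF U adj this] show ?thesis
    unfolding U_def[symmetric] unitary_mat_def inverts_mat_def
    by (simp add: dim mat_adjoint_dim)
qed

lemma code_perfect: "perfect_code gaussian_rats (conj_auto 1) \<i> nus 15"
  by (simp del: One_nat_def add: perfect_code_def code_full_rate code_nonvanishing_det code_unitary)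

lemma nus_code_data: "code_data theta_field gaussian_rats (conj_auto 1) \<i> nus 15"
proof -
  have cr: "cring (ring_of_integers theta_field)" by (rule ring_of_integers_cring[OF theta_field_subfield])
  have "ideal (cgenideal (ring_of_integers theta_field) alpha) (ring_of_integers theta_field)"
    using alpha_theta_ints by (intro cring.cgenideal_ideal[OF cr]) (simp add: theta_ints_carrier)
  moreover have "1 * alpha \<in> cgenideal (ring_of_integers theta_field) alpha"
    unfolding alpha_ideal using theta_ints_gaussian[OF gaussian_ints_1] by blast
  then have "cgenideal (ring_of_integers theta_field) alpha \<noteq> {0}" using alpha_nonzero by auto
  moreover have "is_module_basis (carrier (ring_of_integers gaussian_rats)) nus
      (cgenideal (ring_of_integers theta_field) alpha)"
    using nu_module_basis by (simp add: gaussian_ints_carrier nus_def)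
  ultimately show ?thesis
    unfolding code_data_def length_nus
    using theta_field_cyclic_extension conj_auto_generator gaussian_rats_i adjoin_i by auto
qed

theorem mainTheorem3:
  fixes \<zeta> \<theta> \<gamma> \<alpha> \<nu>1 \<nu>2 \<nu>3 \<nu>4 :: complex
    and F K I :: "complex set"
  assumes "\<zeta> = exp (2 * of_real pi * \<i> / 15)"
    and "\<theta> = of_real (2 * cos (2 * pi / 15))"
    and "F = adjoin {\<i>}"
    and "K = adjoin {\<i>, \<theta>}"
    and "\<gamma> = \<i>"
    and "\<alpha> = (1 - 3 * \<i>) + \<i> * \<theta>^2"
    and "I = cgenideal (ring_of_integers K) \<alpha>"
    and "\<nu>1 = (1 - 3 * \<i>) + \<i> * \<theta>^2"
    and "\<nu>2 = (1 - 3 * \<i>) * \<theta> + \<i> * \<theta>^3"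
    and "\<nu>3 = - \<i> + (-3 + 4 * \<i>) * \<theta> + (1 - \<i>) * \<theta>^3"
    and "\<nu>4 = (-1 + \<i>) - 3 * \<theta> + \<theta>^2 + \<theta>^3"
  shows "\<theta> = \<zeta> + inverse \<zeta> \<and>
    (\<exists>!\<sigma>. \<sigma> \<in> carrier (galois_group K F) \<and> \<sigma> (\<zeta> + inverse \<zeta>) = \<zeta>^2 + inverse (\<zeta>^2)) \<and>
    is_module_basis gaussian_ints [\<nu>1, \<nu>2, \<nu>3, \<nu>4] I \<and>
    (\<forall>\<sigma>. \<sigma> \<in> carrier (galois_group K F) \<and> \<sigma> (\<zeta> + inverse \<zeta>) = \<zeta>^2 + inverse (\<zeta>^2) \<longrightarrow>
       is_generator (galois_group K F) \<sigma> \<and>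
       code_data K F \<sigma> \<gamma> [\<nu>1, \<nu>2, \<nu>3, \<nu>4] 15 \<and>
       perfect_code F \<sigma> \<gamma> [\<nu>1, \<nu>2, \<nu>3, \<nu>4] 15)"
proof -
  have th: "\<theta> = theta" using assms(2) by (simp add: theta_def)
  have F: "F = gaussian_rats" using assms(3) adjoin_i by simp
  have K: "K = theta_field" using assms(4) adjoin_i_theta th by simp
  have al: "\<alpha> = alpha" using assms(6) th by (simp add: alpha_def)
  have nus: "[\<nu>1, \<nu>2, \<nu>3, \<nu>4] = nus"
    unfolding nus_def One_nat_def nu_simps assms(8-11) th ..
  have "\<zeta> = cis (2 * pi / 15)"
    unfolding assms(1) cis_conv_exp by (simp add: mult_ac)
  then have z: "\<zeta> + inverse \<zeta> = theta"
    by (simp add: cis_inverse theta_def complex_eq_iff)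
  have "\<zeta> \<noteq> 0" by (simp add: assms(1))
  then have "\<zeta>\<^sup>2 + inverse (\<zeta>\<^sup>2) = (\<zeta> + inverse \<zeta>)\<^sup>2 - 2"
    by (simp add: power2_sum power_inverse)
  then have z2: "\<zeta>\<^sup>2 + inverse (\<zeta>\<^sup>2) = theta\<^sup>2 - 2" by (simp only: z)
  have "conj_auto 1 theta = theta\<^sup>2 - 2"
    by (simp add: conj_auto_def theta_field_theta conj_map_theta)
  \<comment> \<open>The image of \<open>theta\<close> determines an automorphism, so the unique
    existence and the statement for all \<sigma> both reduce to \<open>conj_auto 1\<close>.\<close>
  then have sig: "\<sigma> \<in> carrier theta_galois \<and> \<sigma> theta = theta\<^sup>2 - 2 \<longleftrightarrow> \<sigma> = conj_auto 1" for \<sigma>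
    using conj_auto_unique conj_auto_galois[of 1] by blast
  show ?thesis
    unfolding z z2 F K assms(5,7) al nus sig th
    using conj_auto_generator nus_code_data code_perfect nu_module_basis
    by (simp add: nus_def)
qed

end
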